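(* Let $\Lambda$ be an admissible, minimally stable, polytopal configuration with $d\ge1$, with visible block $A$ and indispensable block $B$. Put $K_B=\ker B$, $C_B=\operatorname{coker}B$, and identify $C_B^\vee$ with $\ker(B^\vee)$. There is a canonical exact sequence $$0\longrightarrow C_B^\vee\longrightarrow W_\Lambda^{1,0}\overset{c_\Lambda}{\longrightarrow}R_\Lambda^{1,1}\overset{\beta_\Lambda}{\longrightarrow}K_B^\vee\longrightarrow0,$$ in which the (well-defined) maps are $$\eta\longmapsto[(0,\eta)],\qquad c_\Lambda([(u,\eta)])=[u]:=\Bigl[\sum_{j=1}^Nu_jv_j\Bigr],\qquad \beta_\Lambda([u])=(A^\vee u)|_{K_B}.$$
   Context: LVM data. Convex hulls are over $\mathbb R$ with $\mathbb C^m\cong\mathbb R^{2m}$; $\langle-,-\rangle$ is the standard complex-bilinear pairing on $\mathbb C^m$. A configuration $\Lambda=(\Lambda_1,\dots,\Lambda_n)$ in $\mathbb C^m$, $m\ge1$, is admissible if $0\in\operatorname{conv}(\Lambda_1,\dots,\Lambda_n)$ and $0\notin\operatorname{conv}\{\Lambda_i:i\in I\}$ whenever $1\le|I|\le2m$. A label $a$ is indispensable if $0\notin\operatorname{conv}\{\Lambda_i:i\neq a\}$; otherwise visible. $\Lambda$ is minimally stable if there are exactly $m+1$ indispensable labels $a_0,\dots,a_m$. The visible labels are identified with $[N]=\{1,\dots,N\}$, $N=n-m-1$. The visible complex $K$ on $[N]$ has faces the $J\subseteq[N]$ with $0\in\operatorname{conv}\{\Lambda_i:i\notin J\}$ (complement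 in the full label set). Put $d=n-2m-1=N-m$. $\Lambda$ is polytopal if $K$ is the boundary complex of a $d$-dimensional simplicial convex polytope with vertex set $[N]$. Blocks: $A:\mathbb C^m\to\mathbb C^N$ and $B:\mathbb C^m\to\mathbb C^m$ have rows $A_j(T)=\langle\Lambda_j-\Lambda_{a_0},T\rangle$ and $B_\mu(T)=\langle\Lambda_{a_\mu}-\Lambda_{a_0},T\rangle$ ($1\le j\le N$, $1\le\mu\le m$); $A^\vee,B^\vee$ are the dual maps. Let $\mathfrak h_\Lambda\subset\mathbb C^{N+m}$ be the image of $\binom AB:\mathbb C^m\to\mathbb C^N\oplus\mathbb C^m$ and $\overline{\mathfrak h_\Lambda}$ its complex conjugate. Covectors on $\mathbb C^{N+m}$ are written $(u,\eta)\in(\mathbb C^N)^\vee\oplus(\mathbb C^m)^\vee$, so $\operatorname{Ann}(\mathfrak h_\Lambda)=\{(u,\eta):A^\vee u+B^\vee\eta=0\}$. Put $\mathcal L_\Lambda=\operatorname{Ann}(\mathfrak h_\Lambda+\overline{\mathfrak h_\Lambda})$ and $W_\Lambda^{1,0}=\operatorname{Ann}(\mathfrak h_\Lambda)/\mathcal L_\Lambda$. Ring: $R_\Lambda=\mathbb C[v_1,\dots,v_N]/(I_K+J_\Lambda)$, where $I_K$ is the Stanley–Reisner ideal generated by $\prod_{j\in I}v_j$, $I\subseteq[N]$, $I\notin K$, and $J_\Lambda$ is generated by the linear forms $\sum_{j=1}^N u_jv_j$ for $(u,\eta)\in\mathcal L_\Lambda$. The variables have bidegree $(1,1)$; $R_\Lambda^{1,1}=(\mathbb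 C^N)^\vee/(J_\Lambda)_1$ is the linear part of $R_\Lambda$, where $u\in(\mathbb C^N)^\vee$ corresponds to $\sum_ju_jv_j$. (The map $c_\Lambda$ is the differential on holomorphic leafwise generators of the Dolbeault model of the associated LVM manifold.) *)

theory Defs
  imports
    "HOL-Analysis.Analysis"
    "HOL-Algebra.QuotRing"
    "HOL-Algebra.Module"
    "HOL-Algebra.Algebraic_Closure_Type"
    "HOL-Library.Poly_Mapping"
begin

section \<open>Complex vector spaces, quotients, duals, exact sequences\<close>

text \<open>
  A complex vector space is a HOL-Algebra module over the field \<open>ring_of_type_algebra\<close> of complex
  numbers. The module record extends the ring record; its multiplication and unit are irrelevant
  and left undefined.
\<close>

abbreviation CC :: "complex ring" where
  "CC \<equiv> ring_of_type_algebra"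

definition vec_module :: "(complex ^ 'i) set \<Rightarrow> (complex, complex ^ 'i) module" where
  "vec_module S = \<lparr>carrier = S, mult = undefined, one = undefined,
     zero = 0, add = (+), smult = (*s)\<rparr>"

definition scalar_module :: "(complex, complex) module" where
  "scalar_module = \<lparr>carrier = UNIV, mult = undefined, one = undefined,
     zero = 0, add = (+), smult = (*)\<rparr>"

definition quot_module :: "('r, 'a) module \<Rightarrow> 'a set \<Rightarrow> ('r, 'a set) module" where
  "quot_module M L = \<lparr>carrier = a_rcosets\<^bsub>M\<^esub> L, mult = undefined, one = undefined,
     zero = L, add = set_add M, smult = (\<lambda>c Z. \<Union>x\<in>Z. L +>\<^bsub>M\<^esub> (c \<odot>\<^bsub>M\<^esub> x))\<rparr>"

definition linear_maps :: "(complex, 'a) module \<Rightarrow> (complex, 'b) module \<Rightarrow> ('a \<Rightarrow> 'b) set" where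
  "linear_maps M N = {f \<in> carrier M \<rightarrow> carrier N.
     (\<forall>x\<in>carrier M. \<forall>y\<in>carrier M. f (x \<oplus>\<^bsub>M\<^esub> y) = f x \<oplus>\<^bsub>N\<^esub> f y) \<and>
     (\<forall>c. \<forall>x\<in>carrier M. f (c \<odot>\<^bsub>M\<^esub> x) = c \<odot>\<^bsub>N\<^esub> f x)}"

text \<open>
  Functionals are taken extensional, so that each has a single representing HOL function.
\<close>

definition dual_module :: "(complex, 'a) module \<Rightarrow> (complex, 'a \<Rightarrow> complex) module" where
  "dual_module M = \<lparr>carrier = linear_maps M scalar_module \<inter> extensional (carrier M),
     mult = undefined, one = undefined,
     zero = (\<lambda>x\<in>carrier M. 0),
     add = (\<lambda>f g. \<lambda>x\<in>carrier M. f x + g x),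
     smult = (\<lambda>c f. \<lambda>x\<in>carrier M. c * f x)\<rparr>"

definition linear_isos :: "(complex, 'a) module \<Rightarrow> (complex, 'b) module \<Rightarrow> ('a \<Rightarrow> 'b) set" where
  "linear_isos M N = {f \<in> linear_maps M N. bij_betw f (carrier M) (carrier N)}"

text \<open>Exactness of \<open>0 \<rightarrow> M1 \<rightarrow> M2 \<rightarrow> M3 \<rightarrow> M4 \<rightarrow> 0\<close> with maps \<open>f\<close>, \<open>g\<close>, \<open>h\<close>.\<close>

definition exact_sequence4 ::
  "(complex, 'a) module \<Rightarrow> ('a \<Rightarrow> 'b) \<Rightarrow> (complex, 'b) module \<Rightarrow> ('b \<Rightarrow> 'c) \<Rightarrow>
   (complex, 'c) module \<Rightarrow> ('c \<Rightarrow> 'd) \<Rightarrow> (complex, 'd) module \<Rightarrow> bool" where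
  "exact_sequence4 M1 f M2 g M3 h M4 \<longleftrightarrow>
     module CC M1 \<and> module CC M2 \<and> module CC M3 \<and> module CC M4 \<and>
     f \<in> linear_maps M1 M2 \<and> g \<in> linear_maps M2 M3 \<and> h \<in> linear_maps M3 M4 \<and>
     inj_on f (carrier M1) \<and>
     f ` carrier M1 = {x \<in> carrier M2. g x = \<zero>\<^bsub>M3\<^esub>} \<and>
     g ` carrier M2 = {x \<in> carrier M3. h x = \<zero>\<^bsub>M4\<^esub>} \<and>
     h ` carrier M3 = carrier M4"


section \<open>Configurations\<close>

text \<open>
  The full label set is the finite type \<open>'n\<close>, so \<open>n = CARD('n)\<close>; \<open>'m\<close> indexes the coordinates, so
  \<open>m = CARD('m)\<close>. A configuration is a function, so repetitions among the vectors are allowed;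
  \<open>convex hull\<close> is the hull over the reals.
\<close>

definition admissible :: "('n::finite \<Rightarrow> complex ^ 'm) \<Rightarrow> bool" where
  "admissible \<Lambda> \<longleftrightarrow> 0 \<in> convex hull range \<Lambda> \<and>
     (\<forall>I. 1 \<le> card I \<and> card I \<le> 2 * CARD('m) \<longrightarrow> 0 \<notin> convex hull (\<Lambda> ` I))"

definition indispensable :: "('n::finite \<Rightarrow> complex ^ 'm) \<Rightarrow> 'n \<Rightarrow> bool" where
  "indispensable \<Lambda> a \<longleftrightarrow> 0 \<notin> convex hull (\<Lambda> ` {i. i \<noteq> a})"

definition minimally_stable :: "('n::finite \<Rightarrow> complex ^ 'm) \<Rightarrow> bool" where
  "minimally_stable \<Lambda> \<longleftrightarrow> card {a. indispensable \<Lambda> a} = CARD('m) + 1"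

text \<open>
  A labelling identifies the visible labels with the finite type \<open>'v\<close> (in the role of \<open>[N]\<close>) and
  enumerates the indispensable ones as \<open>a None\<close> (for \<open>a\<^sub>0\<close>) and \<open>a (Some \<mu>)\<close> (for \<open>a\<^sub>\<mu>\<close>).
\<close>

definition labelling ::
  "('n::finite \<Rightarrow> complex ^ 'm) \<Rightarrow> ('v::finite \<Rightarrow> 'n) \<Rightarrow> ('m option \<Rightarrow> 'n) \<Rightarrow> bool" where
  "labelling \<Lambda> vis a \<longleftrightarrow>
     bij_betw vis UNIV {i. \<not> indispensable \<Lambda> i} \<and> bij_betw a UNIV {i. indispensable \<Lambda> i}"

definition visible_complex :: "('n::finite \<Rightarrow> complex ^ 'm) \<Rightarrow> ('v::finite \<Rightarrow> 'n) \<Rightarrow> 'v set set" where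
  "visible_complex \<Lambda> vis = {J. 0 \<in> convex hull (\<Lambda> ` {i. i \<notin> vis ` J})}"

definition lvm_dim :: "('n::finite \<Rightarrow> complex ^ 'm) \<Rightarrow> int" where
  "lvm_dim \<Lambda> = int CARD('n) - 2 * int CARD('m) - 1"

text \<open>
  \<open>w\<close> labels the vertices of \<open>P\<close>; a face of the boundary complex is the set of labels of the vertices
  of a proper (possibly empty) face of \<open>P\<close>.
\<close>

definition boundary_complex :: "('v \<Rightarrow> 'e::euclidean_space) \<Rightarrow> 'e set \<Rightarrow> 'v set set" where
  "boundary_complex w P = {J. \<exists>F. F face_of P \<and> F \<noteq> P \<and> w ` J = {x. x extreme_point_of F}}"

definition simplicial_polytope :: "'e::euclidean_space set \<Rightarrow> bool" where
  "simplicial_polytope P \<longleftrightarrow> polytope P \<and> (\<forall>F. F facet_of P \<longrightarrow> (\<exists>k. k simplex F))"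

text \<open>
  The ambient space of the polytope is \<open>\<real>\<^sup>N\<close>, which is no restriction: under the standing
  hypotheses \<open>d = N - m < N\<close>, and only the affine span of a \<open>d\<close>-dimensional polytope matters.
\<close>

definition polytopal :: "('n::finite \<Rightarrow> complex ^ 'm) \<Rightarrow> ('v::finite \<Rightarrow> 'n) \<Rightarrow> bool" where
  "polytopal \<Lambda> vis \<longleftrightarrow>
     (\<exists>(P :: (real ^ 'v) set) (w :: 'v \<Rightarrow> real ^ 'v).
        simplicial_polytope P \<and> aff_dim P = lvm_dim \<Lambda> \<and>
        bij_betw w UNIV {x. x extreme_point_of P} \<and>
        visible_complex \<Lambda> vis = boundary_complex w P)"


section \<open>Blocks, annihilators, and the space W\<close>

definition block_A ::
  "('n::finite \<Rightarrow> complex ^ 'm) \<Rightarrow> ('v::finite \<Rightarrow> 'n) \<Rightarrow> ('m option \<Rightarrow> 'n) \<Rightarrow> complex ^ 'm ^ 'v" where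
  "block_A \<Lambda> vis a = (\<chi> j. \<Lambda> (vis j) - \<Lambda> (a None))"

definition block_B :: "('n::finite \<Rightarrow> complex ^ 'm) \<Rightarrow> ('m option \<Rightarrow> 'n) \<Rightarrow> complex ^ 'm ^ 'm" where
  "block_B \<Lambda> a = (\<chi> \<mu>. \<Lambda> (a (Some \<mu>)) - \<Lambda> (a None))"

text \<open>
  Covectors on \<open>\<complex>\<^sup>i\<close> are given by their coordinates, through the complex-bilinear (not Hermitian)
  pairing; the dual of \<open>Z\<close> is then \<open>transpose Z\<close>.
\<close>

definition pairing :: "complex ^ 'i \<Rightarrow> complex ^ 'i \<Rightarrow> complex" where
  "pairing u x = (\<Sum>i\<in>UNIV. u $ i * x $ i)"

definition join :: "complex ^ 'v \<Rightarrow> complex ^ 'm \<Rightarrow> complex ^ ('v + 'm)" where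
  "join u \<eta> = (\<chi> i. case i of Inl j \<Rightarrow> u $ j | Inr \<mu> \<Rightarrow> \<eta> $ \<mu>)"

definition Ann :: "(complex ^ 'i) set \<Rightarrow> (complex ^ 'i) set" where
  "Ann S = {w. \<forall>x\<in>S. pairing w x = 0}"

definition conj_set :: "(complex ^ 'i) set \<Rightarrow> (complex ^ 'i) set" where
  "conj_set S = (\<lambda>x. \<chi> i. cnj (x $ i)) ` S"

definition h_space ::
  "('n::finite \<Rightarrow> complex ^ 'm) \<Rightarrow> ('v::finite \<Rightarrow> 'n) \<Rightarrow> ('m option \<Rightarrow> 'n) \<Rightarrow> (complex ^ ('v + 'm)) set" where
  "h_space \<Lambda> vis a = range (\<lambda>T. join (block_A \<Lambda> vis a *v T) (block_B \<Lambda> a *v T))"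

definition L_space ::
  "('n::finite \<Rightarrow> complex ^ 'm) \<Rightarrow> ('v::finite \<Rightarrow> 'n) \<Rightarrow> ('m option \<Rightarrow> 'n) \<Rightarrow> (complex ^ ('v + 'm)) set" where
  "L_space \<Lambda> vis a =
     Ann {x + y | x y. x \<in> h_space \<Lambda> vis a \<and> y \<in> conj_set (h_space \<Lambda> vis a)}"

definition W10 ::
  "('n::finite \<Rightarrow> complex ^ 'm) \<Rightarrow> ('v::finite \<Rightarrow> 'n) \<Rightarrow> ('m option \<Rightarrow> 'n) \<Rightarrow>
   (complex, (complex ^ ('v + 'm)) set) module" where
  "W10 \<Lambda> vis a = quot_module (vec_module (Ann (h_space \<Lambda> vis a))) (L_space \<Lambda> vis a)"

definition W_class ::
  "('n::finite \<Rightarrow> complex ^ 'm) \<Rightarrow> ('v::finite \<Rightarrow> 'n) \<Rightarrow> ('m option \<Rightarrow> 'n) \<Rightarrow>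
   complex ^ 'v \<Rightarrow> complex ^ 'm \<Rightarrow> (complex ^ ('v + 'm)) set" where
  "W_class \<Lambda> vis a u \<eta> =
     L_space \<Lambda> vis a +>\<^bsub>vec_module (Ann (h_space \<Lambda> vis a))\<^esub> join u \<eta>"


section \<open>The ring R and its linear part\<close>

type_synonym 'v cpoly = "('v \<Rightarrow>\<^sub>0 nat) \<Rightarrow>\<^sub>0 complex"

abbreviation poly_ring :: "'v cpoly ring" where
  "poly_ring \<equiv> ring_of_type_algebra"

definition const_poly :: "complex \<Rightarrow> 'v cpoly" where
  "const_poly c = Poly_Mapping.single 0 c"

definition pvar :: "'v \<Rightarrow> 'v cpoly" where
  "pvar j = Poly_Mapping.single (Poly_Mapping.single j 1) 1"

definition linear_form :: "complex ^ 'v \<Rightarrow> 'v::finite cpoly" where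
  "linear_form u = (\<Sum>j\<in>UNIV. const_poly (u $ j) * pvar j)"

definition SR_ideal :: "'v::finite set set \<Rightarrow> 'v cpoly set" where
  "SR_ideal K = Idl\<^bsub>poly_ring\<^esub> {\<Prod>j\<in>I. pvar j | I. I \<notin> K}"

definition J_ideal ::
  "('n::finite \<Rightarrow> complex ^ 'm) \<Rightarrow> ('v::finite \<Rightarrow> 'n) \<Rightarrow> ('m option \<Rightarrow> 'n) \<Rightarrow> 'v cpoly set" where
  "J_ideal \<Lambda> vis a = Idl\<^bsub>poly_ring\<^esub> {linear_form u | u \<eta>. join u \<eta> \<in> L_space \<Lambda> vis a}"

definition R_ideal ::
  "('n::finite \<Rightarrow> complex ^ 'm) \<Rightarrow> ('v::finite \<Rightarrow> 'n) \<Rightarrow> ('m option \<Rightarrow> 'n) \<Rightarrow> 'v cpoly set" where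
  "R_ideal \<Lambda> vis a = SR_ideal (visible_complex \<Lambda> vis) <+>\<^bsub>poly_ring\<^esub> J_ideal \<Lambda> vis a"

definition R_ring ::
  "('n::finite \<Rightarrow> complex ^ 'm) \<Rightarrow> ('v::finite \<Rightarrow> 'n) \<Rightarrow> ('m option \<Rightarrow> 'n) \<Rightarrow> 'v cpoly set ring" where
  "R_ring \<Lambda> vis a = poly_ring Quot R_ideal \<Lambda> vis a"

definition R_class ::
  "('n::finite \<Rightarrow> complex ^ 'm) \<Rightarrow> ('v::finite \<Rightarrow> 'n) \<Rightarrow> ('m option \<Rightarrow> 'n) \<Rightarrow> 'v cpoly \<Rightarrow> 'v cpoly set" where
  "R_class \<Lambda> vis a p = R_ideal \<Lambda> vis a +>\<^bsub>poly_ring\<^esub> p"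

text \<open>
  The bidegree \<open>(1,1)\<close> part of the ring: the classes of linear forms, with the operations of the
  ring. It is a subspace of the ring itself rather than \<open>(\<complex>\<^sup>N)\<^sup>\<or>/(J\<^sub>\<Lambda>)\<^sub>1\<close>; the two agree because
  every visible label is a vertex of the visible complex, so the Stanley-Reisner ideal contains no
  linear forms.
\<close>

definition R11 ::
  "('n::finite \<Rightarrow> complex ^ 'm) \<Rightarrow> ('v::finite \<Rightarrow> 'n) \<Rightarrow> ('m option \<Rightarrow> 'n) \<Rightarrow>
   (complex, 'v cpoly set) module" where
  "R11 \<Lambda> vis a = \<lparr>carrier = range (\<lambda>u. R_class \<Lambda> vis a (linear_form u)),
     mult = undefined, one = undefined,
     zero = \<zero>\<^bsub>R_ring \<Lambda> vis a\<^esub>, add = (\<oplus>\<^bsub>R_ring \<Lambda> vis a\<^esub>),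
     smult = (\<lambda>c Z. R_class \<Lambda> vis a (const_poly c) \<otimes>\<^bsub>R_ring \<Lambda> vis a\<^esub> Z)\<rparr>"


section \<open>Kernel and cokernel\<close>

definition mat_ker :: "complex ^ 'i ^ 'j \<Rightarrow> (complex ^ 'i) set" where
  "mat_ker Z = {T. Z *v T = 0}"

definition coker :: "complex ^ 'i ^ 'j \<Rightarrow> (complex, (complex ^ 'j) set) module" where
  "coker Z = quot_module (vec_module UNIV) (range ((*v) Z))"

text \<open>
  The functional on the cokernel of \<open>Z\<close> induced by a covector \<open>\<eta>\<close> in the kernel of the dual map; it
  sends the class of \<open>y\<close> to \<open>pairing \<eta> y\<close>. This is the identification of the kernel of the dual map
  with the dual of the cokernel.
\<close>

definition coker_functional :: "complex ^ 'i ^ 'j \<Rightarrow> complex ^ 'j \<Rightarrow> (complex ^ 'j) set \<Rightarrow> complex" where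
  "coker_functional Z \<eta> = (\<lambda>Y\<in>carrier (coker Z). THE z. \<forall>y\<in>Y. pairing \<eta> y = z)"

end

(*
Exactness in the middle is linear algebra over the blocks: (u, \<eta>) annihilates h iff
A\<^sup>T u + B\<^sup>T \<eta> = 0, and a covector killing ker B lies in the image of B\<^sup>T. Three inputs are
not formal.

The map c is well defined and its kernel can be read off linear forms because R has in degree
one no relations besides J: every visible label is a vertex of K, so all generators of I_K have
degree at least two.

The first map is injective because the m + 1 indispensable vectors are affinely independent over
the reals. If (0, \<eta>) lies in L, then the real and the imaginary part of \<eta> give real affine
dependences of these vectors.

The last map is surjective because ker A and ker B meet only in 0: a nonzero T in both would put all
the vectors of the configuration into a real hyperplane through 0, and Caratheodory's theorem would
exhibit 0 as a convex combination of at most 2m of them, against admissibility.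
*)

theory Submission
  imports Defs
begin

unbundle no fps_syntax

section \<open>Modules over the complex numbers: images, factorization, duals and quotients\<close>

lemma CC_simps [simp]:
  "carrier CC = UNIV" "add CC = (+)" "mult CC = (*)" "zero CC = 0" "one CC = 1"
  by (simp_all add: ring_of_type_algebra_def)

lemma vec_module_simps [simp]:
  "carrier (vec_module S) = S" "add (vec_module S) = (+)" "zero (vec_module S) = 0"
  "smult (vec_module S) = (*s)"
  by (simp_all add: vec_module_def)

lemma dual_module_simps [simp]:
  "carrier (dual_module M) = linear_maps M scalar_module \<inter> extensional (carrier M)"
  "add (dual_module M) = (\<lambda>f g. \<lambda>x\<in>carrier M. f x + g x)"
  "zero (dual_module M) = (\<lambda>x\<in>carrier M. 0)"
  "smult (dual_module M) = (\<lambda>c f. \<lambda>x\<in>carrier M. c * f x)"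
  by (simp_all add: dual_module_def)

lemma linear_maps_scalar_iff:
  "f \<in> linear_maps M scalar_module \<longleftrightarrow>
     (\<forall>x\<in>carrier M. \<forall>y\<in>carrier M. f (x \<oplus>\<^bsub>M\<^esub> y) = f x + f y) \<and>
     (\<forall>c. \<forall>x\<in>carrier M. f (c \<odot>\<^bsub>M\<^esub> x) = c * f x)"
  by (auto simp: linear_maps_def scalar_module_def)

lemma module_vec_module:
  assumes "vec.subspace S"
  shows "module CC (vec_module S)"
proof (rule moduleI)
  show "abelian_group (vec_module S)"
  proof (rule abelian_groupI)
    fix x assume "x \<in> carrier (vec_module S)"
    then have "- x \<in> S" by (simp add: assms vec.subspace_neg)
    then show "\<exists>y\<in>carrier (vec_module S). y \<oplus>\<^bsub>vec_module S\<^esub> x = \<zero>\<^bsub>vec_module S\<^esub>"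
      by (intro bexI[of _ "- x"]) auto
  qed (use assms in \<open>auto simp: vec.subspace_add vec.subspace_0 add_ac\<close>)
qed (use assms in \<open>auto simp: vec.subspace_scale vec.scale_left_distrib vec.scale_right_distrib
       field.axioms(1) domain.axioms(1) cring_from_type_algebra
     vector_add_ldistrib vector_sadd_rdistrib vector_smult_assoc\<close>)

text \<open>Every element of \<open>N\<close> is a value of \<open>p\<close>, so each module law of
  \<open>N\<close> is the image under \<open>p\<close> of the same law in \<open>M\<close>. This
  supplies the module structure both of the quotients by subspaces and of
  \<open>R11\<close>.\<close>

lemma module_linear_image:
  assumes M: "module CC M"
    and carrier: "carrier N = p ` carrier M" and zero: "\<zero>\<^bsub>N\<^esub> = p \<zero>\<^bsub>M\<^esub>"
    and add: "\<And>x y. x \<in> carrier M \<Longrightarrow> y \<in> carrier M \<Longrightarrow> p x \<oplus>\<^bsub>N\<^esub> p y = p (x \<oplus>\<^bsub>M\<^esub> y)"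
    and smult: "\<And>c x. x \<in> carrier M \<Longrightarrow> c \<odot>\<^bsub>N\<^esub> p x = p (c \<odot>\<^bsub>M\<^esub> x)"
  shows "module CC N" "p \<in> linear_maps M N"
proof -
  interpret M: module CC M by (rule M)
  show "module CC N"
  proof (rule moduleI)
    show "abelian_group N"
    proof (rule abelian_groupI)
      fix x assume "x \<in> carrier N"
      then obtain x' where "x' \<in> carrier M" "x = p x'" using carrier by auto
      then show "\<exists>y\<in>carrier N. y \<oplus>\<^bsub>N\<^esub> x = \<zero>\<^bsub>N\<^esub>"
        using M.l_neg by (intro bexI[of _ "p (\<ominus>\<^bsub>M\<^esub> x')"]) (auto simp: add zero carrier)
    qed (auto simp: carrier add zero M.M.a_assoc M.M.a_comm M.M.a_lcomm)
  qed (auto simp: carrier add smult M.smult_r_distr M.smult_l_distr[simplified]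
         M.smult_assoc1[simplified] M.smult_one[simplified] cring_from_type_algebra)
  show "p \<in> linear_maps M N"
    by (auto simp: linear_maps_def carrier add smult)
qed

text \<open>Since \<open>p\<close> is onto, linearity of a map out of \<open>N\<close> may be
  checked on representatives in \<open>M\<close>. All three maps of the exact sequence are shown to
  be linear in this way.\<close>

lemma linear_maps_factor:
  assumes M: "module CC M" and p: "p \<in> linear_maps M N" and surj: "p ` carrier M = carrier N"
    and q: "q \<in> linear_maps M P" and g: "\<And>x. x \<in> carrier M \<Longrightarrow> g (p x) = q x"
  shows "g \<in> linear_maps N P"
proof -
  interpret M: module CC M by (rule M)
  have padd: "p x \<oplus>\<^bsub>N\<^esub> p y = p (x \<oplus>\<^bsub>M\<^esub> y)" if "x \<in> carrier M" "y \<in> carrier M" for x y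
    using p that by (auto simp: linear_maps_def)
  have psm: "c \<odot>\<^bsub>N\<^esub> p x = p (c \<odot>\<^bsub>M\<^esub> x)" if "x \<in> carrier M" for x c
    using p that by (auto simp: linear_maps_def)
  show ?thesis
    using q unfolding linear_maps_def
    by (auto simp: surj[symmetric] padd psm g)
qed

text \<open>A prescription on representatives that is constant on the fibres of \<open>p\<close>
  descends to classes: the value at a class is read off at a representative picked by
  \<open>inv_into\<close>. The maps of the sequence are obtained through it.\<close>

lemma ex_factor:
  assumes "\<And>x y. x \<in> S \<Longrightarrow> y \<in> S \<Longrightarrow> p x = p y \<Longrightarrow> q x = q y"
  shows "\<exists>g. \<forall>x\<in>S. g (p x) = q x"
  by (intro exI[of _ "\<lambda>z. q (inv_into S p z)"] ballI)
    (metis assms f_inv_into_f imageI inv_into_into)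

lemma module_dual_module:
  assumes "module CC M"
  shows "module CC (dual_module M)"
proof -
  interpret M: module CC M by (rule assms)
  have sm: "c \<odot>\<^bsub>M\<^esub> x \<in> carrier M" if "x \<in> carrier M" for c x using that by simp
  show ?thesis
  proof (rule moduleI)
    show "abelian_group (dual_module M)"
    proof (rule abelian_groupI)
      fix f assume f: "f \<in> carrier (dual_module M)"
      let ?g = "\<lambda>x\<in>carrier M. - f x"
      have "?g \<in> carrier (dual_module M)"
        using f by (auto simp: linear_maps_scalar_iff sm)
      then show "\<exists>g\<in>carrier (dual_module M). g \<oplus>\<^bsub>dual_module M\<^esub> f = \<zero>\<^bsub>dual_module M\<^esub>"
        by (intro bexI[of _ ?g]) auto
    next
      fix f assume "f \<in> carrier (dual_module M)"
      \<comment> \<open>The operations of \<open>dual_module\<close> restrict their results to the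
        carrier, so the neutral element acts trivially because \<open>f\<close> is itself
        extensional.\<close>
      then show "\<zero>\<^bsub>dual_module M\<^esub> \<oplus>\<^bsub>dual_module M\<^esub> f = f"
        by (auto simp: extensional_def fun_eq_iff)
    qed (auto simp: linear_maps_scalar_iff sm algebra_simps restrict_def fun_eq_iff extensional_def)
  next
    fix f assume "f \<in> carrier (dual_module M)"
    then show "\<one>\<^bsub>CC\<^esub> \<odot>\<^bsub>dual_module M\<^esub> f = f"
      by (auto simp: extensional_def fun_eq_iff)
  qed (auto simp: linear_maps_scalar_iff sm algebra_simps restrict_def fun_eq_iff
       extensional_def cring_from_type_algebra)
qed

lemma coset_vec_module: "L +>\<^bsub>vec_module S\<^esub> x = (\<lambda>l. l + x) ` L"
  by (auto simp: a_r_coset_def r_coset_def)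

lemma coset_vec_module_eq_iff:
  assumes "vec.subspace L"
  shows "L +>\<^bsub>vec_module S\<^esub> x = L +>\<^bsub>vec_module S\<^esub> y \<longleftrightarrow> x - y \<in> L"
proof
  assume "L +>\<^bsub>vec_module S\<^esub> x = L +>\<^bsub>vec_module S\<^esub> y"
  then have "0 + x \<in> (\<lambda>l. l + y) ` L"
    using vec.subspace_0[OF assms] unfolding coset_vec_module by blast
  then show "x - y \<in> L" by auto
next
  assume d: "x - y \<in> L"
  have "l + x \<in> (\<lambda>l. l + y) ` L" if "l \<in> L" for l
    using vec.subspace_add[OF assms that d] by (intro image_eqI[of _ _ "l + (x - y)"]) auto
  moreover have "l + y \<in> (\<lambda>l. l + x) ` L" if "l \<in> L" for l
    using vec.subspace_diff[OF assms that d] by (intro image_eqI[of _ _ "l - (x - y)"]) auto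
  ultimately show "L +>\<^bsub>vec_module S\<^esub> x = L +>\<^bsub>vec_module S\<^esub> y"
    unfolding coset_vec_module by blast
qed

lemma carrier_quot_vec_module:
  "carrier (quot_module (vec_module S) L) = (\<lambda>x. L +>\<^bsub>vec_module S\<^esub> x) ` S"
  by (auto simp: quot_module_def A_RCOSETS_def RCOSETS_def a_r_coset_def)

lemma
  assumes S: "vec.subspace S" and L: "vec.subspace L"
  shows module_quot_vec_module: "module CC (quot_module (vec_module S) L)"
    and coset_linear_map:
      "(\<lambda>x. L +>\<^bsub>vec_module S\<^esub> x) \<in> linear_maps (vec_module S) (quot_module (vec_module S) L)"
proof -
  let ?p = "\<lambda>x. L +>\<^bsub>vec_module S\<^esub> x"
  have add: "?p x \<oplus>\<^bsub>quot_module (vec_module S) L\<^esub> ?p y = ?p (x + y)" for x y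
  proof -
    have "l + x + (l' + y) \<in> (\<lambda>l. l + (x + y)) ` L" if "l \<in> L" "l' \<in> L" for l l'
      using vec.subspace_add[OF L that] by (intro image_eqI[of _ _ "l + l'"]) (auto simp: add_ac)
    moreover have "\<exists>l1\<in>L. \<exists>l2\<in>L. l + (x + y) = l1 + x + (l2 + y)" if "l \<in> L" for l
      using that vec.subspace_0[OF L] by (intro bexI[of _ l] bexI[of _ 0]) (auto simp: add_ac)
    ultimately show ?thesis
      unfolding quot_module_def coset_vec_module
      by (fastforce simp: set_add_def set_mult_def)
  qed
  have smult: "c \<odot>\<^bsub>quot_module (vec_module S) L\<^esub> ?p x = ?p (c *s x)" for c x
  proof -
    have "?p (c *s y) = ?p (c *s x)" if "y \<in> ?p x" for y
    proof -
      from that obtain l where "l \<in> L" "y = l + x" by (auto simp: coset_vec_module)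
      then have "c *s y - c *s x \<in> L"
        using vec.subspace_scale[OF L] by (simp add: vec.scale_right_distrib)
      then show ?thesis using coset_vec_module_eq_iff[OF L] by blast
    qed
    \<comment> \<open>The scalar multiple is a union over all representatives of one and the same
      coset; the index set must be nonempty for the union to be that coset.\<close>
    moreover have "?p x \<noteq> {}" using vec.subspace_0[OF L] by (auto simp: coset_vec_module)
    ultimately show ?thesis by (auto simp: quot_module_def)
  qed
  have zero: "\<zero>\<^bsub>quot_module (vec_module S) L\<^esub> = ?p 0"
    by (simp add: quot_module_def coset_vec_module)
  note image = module_linear_image[OF module_vec_module[OF S], of _ ?p,
      unfolded vec_module_simps, OF carrier_quot_vec_module zero add smult]
  show "module CC (quot_module (vec_module S) L)"
    by (rule image)
  show "?p \<in> linear_maps (vec_module S) (quot_module (vec_module S) L)"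
    by (rule image)
qed

section \<open>The complex-bilinear pairing and the dual of a cokernel\<close>

lemma pairing_add_left: "pairing (u + v) x = pairing u x + pairing v x"
  and pairing_diff_left: "pairing (u - v) x = pairing u x - pairing v x"
  and pairing_scale_left: "pairing (c *s u) x = c * pairing u x"
  and pairing_zero_left: "pairing 0 x = 0"
  and pairing_add_right: "pairing u (x + y) = pairing u x + pairing u y"
  and pairing_diff_right: "pairing u (x - y) = pairing u x - pairing u y"
  and pairing_scale_right: "pairing u (c *s x) = c * pairing u x"
  and pairing_zero_right: "pairing u 0 = 0"
  by (simp_all add: pairing_def sum.distrib sum_subtractf sum_distrib_left algebra_simps)

lemma pairing_axis_right: "pairing u (axis i c) = u $ i * c"
  by (simp add: pairing_def axis_def if_distrib sum.delta' cong: if_cong)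

lemma pairing_transpose:
  fixes Z :: "complex ^ 'i::finite ^ 'j::finite"
  shows "pairing (transpose Z *v u) T = pairing u (Z *v T)"
proof -
  have "pairing (transpose Z *v u) T = (\<Sum>i\<in>UNIV. \<Sum>j\<in>UNIV. Z $ j $ i * u $ j * T $ i)"
    by (simp add: pairing_def matrix_vector_mult_def transpose_def sum_distrib_right)
  also have "\<dots> = (\<Sum>j\<in>UNIV. \<Sum>i\<in>UNIV. Z $ j $ i * u $ j * T $ i)"
    by (rule sum.swap)
  also have "\<dots> = pairing u (Z *v T)"
    by (simp add: pairing_def matrix_vector_mult_def sum_distrib_left mult_ac)
  finally show ?thesis .
qed

lemma pairing_left_eq_0_iff: "(\<forall>x. pairing u x = 0) \<longleftrightarrow> u = 0"
proof
  assume "\<forall>x. pairing u x = 0"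
  then have "u $ i * 1 = 0" for i
    by (metis pairing_axis_right)
  then show "u = 0" by (simp add: vec_eq_iff)
qed (simp add: pairing_zero_left)

lemma linear_functional_eq_pairing:
  fixes g :: "complex ^ 'i::finite \<Rightarrow> complex"
  assumes "\<And>x y. g (x + y) = g x + g y" "\<And>c x. g (c *s x) = c * g x"
  shows "g x = pairing (\<chi> i. g (axis i 1)) x"
proof -
  have zero: "g 0 = 0" using assms(2)[of 0 0] by simp
  have sum: "g (sum f S) = (\<Sum>i\<in>S. g (f i))" if "finite S" for f :: "'i \<Rightarrow> _" and S
    using that by (induction S) (auto simp: zero assms)
  have "g x = g (\<Sum>i\<in>UNIV. x $ i *s axis i 1)"
    by (simp add: basis_expansion)
  also have "\<dots> = pairing (\<chi> i. g (axis i 1)) x"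
    by (simp add: sum assms pairing_def mult_ac)
  finally show ?thesis .
qed

lemma subspace_mat_ker: "vec.subspace (mat_ker Z)"
  by (auto simp: vec.subspace_def mat_ker_def matrix_vector_right_distrib
      vector_scalar_commute)

lemma subspace_range_mult: "vec.subspace (range ((*v) (Z :: complex ^ 'i ^ 'j)))"
  by (auto simp: vec.subspace_def matrix_vector_right_distrib[symmetric]
      vector_scalar_commute[symmetric] intro: range_eqI[of _ _ 0])

lemma subspace_Ann: "vec.subspace (Ann S)"
  by (auto simp: vec.subspace_def Ann_def pairing_add_left pairing_scale_left pairing_zero_left)

text \<open>The double annihilator property: what kills the kernel of \<open>Z\<close> comes from
  the dual map. With a linear \<open>g\<close> that inverts \<open>Z\<close> on its range, the
  functional sending \<open>y\<close> to \<open>pairing w (g y)\<close> is the covector \<eta>; it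
  works because \<open>T\<close> and \<open>g (Z *v T)\<close> differ by an element of the
  kernel.\<close>

lemma in_range_transposeI:
  fixes Z :: "complex ^ 'i::finite ^ 'j::finite"
  assumes "\<And>T. T \<in> mat_ker Z \<Longrightarrow> pairing w T = 0"
  shows "\<exists>\<eta>. w = transpose Z *v \<eta>"
proof -
  obtain g where g: "Vector_Spaces.linear (*s) (*s) g" "\<And>y. y \<in> range ((*v) Z) \<Longrightarrow> Z *v g y = y"
    using vec.linear_exists_right_inverse_on[of "(*v) Z" UNIV] matrix_vector_mul_linear_gen[of Z]
    by auto
  interpret g: Vector_Spaces.linear "(*s)" "(*s)" g by (rule g(1))
  define \<eta> where "\<eta> = (\<chi> j. pairing w (g (axis j 1)))"
  have eta: "pairing \<eta> y = pairing w (g y)" for y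
    unfolding \<eta>_def
    by (rule linear_functional_eq_pairing[symmetric, of "\<lambda>y. pairing w (g y)"])
      (simp_all add: g.add g.scale pairing_add_right pairing_scale_right)
  have "pairing (w - transpose Z *v \<eta>) T = 0" for T
  proof -
    have "T - g (Z *v T) \<in> mat_ker Z"
      by (simp add: mat_ker_def matrix_vector_mult_diff_distrib g(2))
    from assms[OF this] show ?thesis
      by (simp add: pairing_diff_left pairing_diff_right pairing_transpose eta
          del: transpose_matrix_vector)
  qed
  then have "w - transpose Z *v \<eta> = 0" using pairing_left_eq_0_iff by blast
  then show ?thesis by auto
qed

text \<open>On \<open>K\<close> the map \<open>Z\<close> has a linear left inverse \<open>g\<close>,
  and \<phi> composed with \<open>g\<close> is a functional on the whole target, hence a covector
  \<open>u\<close>. With \<open>K\<close> the kernel of \<open>B\<close> and \<open>Z\<close> the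
  block \<open>A\<close> this gives surjectivity of the last map.\<close>

lemma functional_eq_pairing_transpose:
  fixes Z :: "complex ^ 'i::finite ^ 'j::finite"
  assumes K: "vec.subspace K" and inj: "\<And>T. T \<in> K \<Longrightarrow> Z *v T = 0 \<Longrightarrow> T = 0"
    and \<phi>: "\<phi> \<in> linear_maps (vec_module K) scalar_module"
  shows "\<exists>u. \<forall>T\<in>K. \<phi> T = pairing (transpose Z *v u) T"
proof -
  have "inj_on ((*v) Z) K"
  proof (rule inj_onI)
    fix x y assume "x \<in> K" "y \<in> K" "Z *v x = Z *v y"
    then have "x - y = 0"
      by (intro inj) (auto simp: matrix_vector_mult_diff_distrib vec.subspace_diff[OF K])
    then show "x = y" by simp
  qed
  then obtain g where g: "range g \<subseteq> K" "Vector_Spaces.linear (*s) (*s) g" "\<And>T. T \<in> K \<Longrightarrow> g (Z *v T) = T"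
    using vec.linear_exists_left_inverse_on[OF matrix_vector_mul_linear_gen[of Z] K] by auto
  interpret g: Vector_Spaces.linear "(*s)" "(*s)" g by (rule g(2))
  have "\<phi> (g y) = pairing (\<chi> j. \<phi> (g (axis j 1))) y" for y
    using range_subsetD[OF g(1)] \<phi>
    by (intro linear_functional_eq_pairing[of "\<lambda>y. \<phi> (g y)"])
      (simp_all add: g.add g.scale linear_maps_scalar_iff)
  then show ?thesis
    using g(3) by (metis pairing_transpose)
qed

text \<open>A covector in the kernel of the dual map kills the range of \<open>B\<close>, so its
  pairing is constant on each coset and the description in \<open>coker_functional\<close> denotes
  that constant.\<close>

lemma coker_functional_coset:
  assumes "\<eta> \<in> mat_ker (transpose B)"
  shows "coker_functional B \<eta> (range ((*v) B) +>\<^bsub>vec_module UNIV\<^esub> y) = pairing \<eta> y"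
proof -
  have 0: "pairing \<eta> (B *v T) = 0" for T
    using assms by (simp add: mat_ker_def pairing_transpose[symmetric] pairing_zero_left)
  \<comment> \<open>This is \<open>y\<close> itself; uniqueness of the described value needs an
    element of the coset.\<close>
  have "B *v 0 + y \<in> range ((*v) B) +>\<^bsub>vec_module UNIV\<^esub> y"
    unfolding coset_vec_module by blast
  then have "(THE z. \<forall>y\<in>range ((*v) B) +>\<^bsub>vec_module UNIV\<^esub> y. pairing \<eta> y = z) = pairing \<eta> y"
    by (intro the_equality) (auto simp: coset_vec_module pairing_add_right 0)
  then show ?thesis
    by (simp add: coker_functional_def coker_def carrier_quot_vec_module)
qed

text \<open>The inverse pulls a functional back along the coset map to a covector of the ambient
  space, which lies in the kernel of the dual map because the coset map kills the range of
  \<open>B\<close>.\<close>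

lemma coker_functional_linear_iso:
  fixes B :: "complex ^ 'i::finite ^ 'j::finite"
  shows "coker_functional B \<in> linear_isos (vec_module (mat_ker (transpose B))) (dual_module (coker B))"
proof -
  let ?K = "mat_ker (transpose B)"
  let ?cl = "\<lambda>y. range ((*v) B) +>\<^bsub>vec_module UNIV\<^esub> y"
  note sub = vec.subspace_UNIV subspace_range_mult[of B]
  note val = coker_functional_coset
  have car: "carrier (coker B) = range ?cl" by (simp add: coker_def carrier_quot_vec_module)
  have cl: "?cl \<in> linear_maps (vec_module UNIV) (coker B)"
    unfolding coker_def by (rule coset_linear_map[OF sub])
  have lin: "coker_functional B \<eta> \<in> carrier (dual_module (coker B))" if "\<eta> \<in> ?K" for \<eta>
  proof -
    have "coker_functional B \<eta> \<in> linear_maps (coker B) scalar_module"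
      by (rule linear_maps_factor[OF module_vec_module[OF vec.subspace_UNIV] cl, of "pairing \<eta>"])
        (auto simp: val[OF that] car linear_maps_scalar_iff pairing_add_right pairing_scale_right)
    then show ?thesis by (simp add: coker_functional_def)
  qed
  have eqI: "f = g" if "f \<in> carrier (dual_module (coker B))" "g \<in> carrier (dual_module (coker B))"
    "\<And>y. f (?cl y) = g (?cl y)" for f g
    using that by (auto intro!: extensionalityI[of f "carrier (coker B)" g] simp: car)
  have K: "vec.subspace ?K" by (rule subspace_mat_ker)
  have dual: "module CC (dual_module (coker B))"
    unfolding coker_def by (intro module_dual_module module_quot_vec_module sub)
  interpret dual: module CC "dual_module (coker B)" by (rule dual)
  have "coker_functional B \<in> linear_maps (vec_module ?K) (dual_module (coker B))"
  proof -
    have "coker_functional B (\<eta> + \<eta>') = coker_functional B \<eta> \<oplus>\<^bsub>dual_module (coker B)\<^esub> coker_functional B \<eta>'"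
      if "\<eta> \<in> ?K" "\<eta>' \<in> ?K" for \<eta> \<eta>'
      by (rule eqI) (use that lin vec.subspace_add[OF K that] in
          \<open>auto simp: val pairing_add_left car intro!: dual.M.a_closed[simplified]\<close>)
    moreover have "coker_functional B (c *s \<eta>) = c \<odot>\<^bsub>dual_module (coker B)\<^esub> coker_functional B \<eta>"
      if "\<eta> \<in> ?K" for c \<eta>
      by (rule eqI) (use that lin vec.subspace_scale[OF K that] in
          \<open>auto simp: val pairing_scale_left car intro!: dual.smult_closed[simplified]\<close>)
    ultimately show ?thesis
      unfolding linear_maps_def by (auto simp: lin simp del: dual_module_simps)
  qed
  moreover have "inj_on (coker_functional B) ?K"
  proof (rule inj_onI)
    fix \<eta> \<eta>' assume h: "\<eta> \<in> ?K" "\<eta>' \<in> ?K" "coker_functional B \<eta> = coker_functional B \<eta>'"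
    then have "pairing (\<eta> - \<eta>') y = 0" for y by (metis val pairing_diff_left right_minus_eq)
    then have "\<eta> - \<eta>' = 0" using pairing_left_eq_0_iff by blast
    then show "\<eta> = \<eta>'" by simp
  qed
  moreover have "f \<in> coker_functional B ` ?K" if f: "f \<in> carrier (dual_module (coker B))" for f
  proof -
    define \<eta> where "\<eta> = (\<chi> j. f (?cl (axis j 1)))"
    have f': "f (Y \<oplus>\<^bsub>coker B\<^esub> Y') = f Y + f Y'" if "Y \<in> range ?cl" "Y' \<in> range ?cl" for Y Y'
      using f that by (auto simp: linear_maps_scalar_iff car)
    have f'': "f (c \<odot>\<^bsub>coker B\<^esub> Y) = c * f Y" if "Y \<in> range ?cl" for Y c
      using f that by (auto simp: linear_maps_scalar_iff car)
    have cl': "?cl (x + y) = ?cl x \<oplus>\<^bsub>coker B\<^esub> ?cl y" "?cl (c *s x) = c \<odot>\<^bsub>coker B\<^esub> ?cl x" for x y c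
      using cl by (simp_all add: linear_maps_def)
    have eta: "f (?cl y) = pairing \<eta> y" for y
      unfolding \<eta>_def
      by (rule linear_functional_eq_pairing[of "\<lambda>y. f (?cl y)"]) (simp_all add: cl' f' f'')
    have "?cl (B *v T) = ?cl 0" for T
      unfolding coset_vec_module_eq_iff[OF sub(2)] by simp
    then have "pairing (transpose B *v \<eta>) T = 0" for T
      by (metis eta pairing_transpose pairing_zero_right)
    then have "\<eta> \<in> ?K" using pairing_left_eq_0_iff by (auto simp: mat_ker_def)
    moreover from this have "f = coker_functional B \<eta>"
      by (intro eqI f lin) (auto simp: eta val)
    ultimately show ?thesis by blast
  qed
  ultimately show ?thesis
    using lin unfolding linear_isos_def bij_betw_def by auto
qed

section \<open>Polynomials: constant and linear coefficients\<close>

abbreviation coef :: "('a \<Rightarrow>\<^sub>0 'b::zero) \<Rightarrow> 'a \<Rightarrow> 'b" where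
  "coef \<equiv> Poly_Mapping.lookup"

lemma poly_mapping_add_eq_0_iff:
  fixes l m :: "'v \<Rightarrow>\<^sub>0 nat"
  shows "l + m = 0 \<longleftrightarrow> l = 0 \<and> m = 0"
  by (auto simp: poly_mapping_eq_iff lookup_add fun_eq_iff)

text \<open>A monomial of degree one splits only trivially, so only two terms of a product
  contribute to its coefficient.\<close>

lemma poly_mapping_add_eq_single_iff:
  fixes l m :: "'v \<Rightarrow>\<^sub>0 nat"
  shows "l + m = Poly_Mapping.single j 1 \<longleftrightarrow>
    l = 0 \<and> m = Poly_Mapping.single j 1 \<or> l = Poly_Mapping.single j 1 \<and> m = 0"
proof
  assume "l + m = Poly_Mapping.single j 1"
  then have sum: "coef l i + coef m i = (1 when j = i)" for i
    by (metis lookup_add lookup_single)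
  then have 0: "coef l i = 0 \<and> coef m i = 0" if "i \<noteq> j" for i
    using that by (metis add_is_0 when_simps(2))
  have "coef l j = 0 \<and> coef m j = 1 \<or> coef l j = 1 \<and> coef m j = 0"
    using sum[of j] by auto
  then show "l = 0 \<and> m = Poly_Mapping.single j 1 \<or> l = Poly_Mapping.single j 1 \<and> m = 0"
  proof (elim disj_forward conj_forward; intro poly_mapping_eqI)
    fix i
    show "coef l i = coef 0 i" if "coef l j = 0"
      using 0[of i] that by (cases "i = j") auto
    show "coef m i = coef 0 i" if "coef m j = 0"
      using 0[of i] that by (cases "i = j") auto
    show "coef m i = coef (Poly_Mapping.single j 1) i" if "coef m j = 1"
      using 0[of i] that by (cases "i = j") (auto simp: lookup_single)
    show "coef l i = coef (Poly_Mapping.single j 1) i" if "coef l j = 1"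
      using 0[of i] that by (cases "i = j") (auto simp: lookup_single)
  qed
qed auto

lemma lookup_times_zero:
  fixes p q :: "'v cpoly"
  shows "coef (p * q) 0 = coef p 0 * coef q 0"
proof -
  have inner: "(\<Sum>m. coef q m when 0 = l + m) = (coef q 0 when l = 0)" for l
  proof -
    have "(coef q m when 0 = l + m) = ((coef q 0 when l = 0) when m = 0)" for m
      using poly_mapping_add_eq_0_iff[of l m] by (auto simp: when_def)
    then show ?thesis by simp
  qed
  show ?thesis
    by (simp only: lookup_mult inner mult_when Sum_any_when_equal)
qed

text \<open>The product rule at the origin: \<open>coef p 0\<close> is the value there and the
  coefficient at \<open>Poly_Mapping.single j 1\<close> is the \<open>j\<close>-th partial
  derivative.\<close>

lemma lookup_times_single:
  fixes p q :: "'v cpoly"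
  shows "coef (p * q) (Poly_Mapping.single j 1) =
    coef p 0 * coef q (Poly_Mapping.single j 1) + coef p (Poly_Mapping.single j 1) * coef q 0"
proof -
  let ?k = "Poly_Mapping.single j (1::nat)"
  have k: "?k \<noteq> 0" by (metis lookup_single_eq lookup_zero zero_neq_one)
  have inner: "(\<Sum>m. coef q m when ?k = l + m) =
      (if l = 0 then coef q ?k else if l = ?k then coef q 0 else 0)" for l
  proof -
    have "(coef q m when ?k = l + m) = (if l = 0 then (coef q ?k when m = ?k)
        else if l = ?k then (coef q 0 when m = 0) else 0)" for m
      using poly_mapping_add_eq_single_iff[of l m j] k by (auto simp: when_def)
    then show ?thesis by simp
  qed
  have "coef (p * q) ?k = (\<Sum>l. coef p l *
      (if l = 0 then coef q ?k else if l = ?k then coef q 0 else 0))"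
    by (simp only: lookup_mult inner)
  also have "\<dots> = (\<Sum>l\<in>{0, ?k}. coef p l *
      (if l = 0 then coef q ?k else if l = ?k then coef q 0 else 0))"
    by (rule Sum_any.expand_superset) auto
  finally show ?thesis using k by simp
qed

lemma lookup_pvar_zero: "coef (pvar j) 0 = 0"
  unfolding pvar_def by (metis lookup_single_not_eq lookup_single_eq lookup_zero zero_neq_one)

lemma linear_form_eq_sum_single:
  "linear_form u = (\<Sum>j\<in>UNIV. Poly_Mapping.single (Poly_Mapping.single j 1) (u $ j))"
  by (simp add: linear_form_def const_poly_def pvar_def mult_single)

lemma linear_form_add: "linear_form (u + v) = linear_form u + linear_form v"
  by (simp add: linear_form_eq_sum_single single_add sum.distrib)

lemma linear_form_diff: "linear_form (u - v) = linear_form u - linear_form v"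
  by (simp add: linear_form_eq_sum_single single_diff sum_subtractf)

lemma linear_form_scale: "linear_form (c *s u) = const_poly c * linear_form u"
  by (simp add: linear_form_eq_sum_single sum_distrib_left const_poly_def mult_single)

lemma linear_form_zero: "linear_form 0 = 0"
  by (simp add: linear_form_eq_sum_single)

lemma lookup_linear_form_zero: "coef (linear_form u) 0 = 0"
  by (simp add: linear_form_def lookup_sum lookup_times_zero lookup_pvar_zero)

lemma single_1_eq_iff:
  "Poly_Mapping.single i (1::nat) = Poly_Mapping.single j 1 \<longleftrightarrow> i = j"
  by (metis lookup_single_eq lookup_single_not_eq zero_neq_one)

lemma lookup_linear_form_single: "coef (linear_form u) (Poly_Mapping.single j 1) = u $ j"
proof -
  have "coef (linear_form u) (Poly_Mapping.single j 1) = (\<Sum>i\<in>UNIV. if i = j then u $ i else 0)"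
    unfolding linear_form_eq_sum_single lookup_sum
    by (intro sum.cong) (simp_all add: lookup_single when_def single_1_eq_iff del: One_nat_def)
  then show ?thesis by simp
qed

text \<open>The gradient at the origin, a left inverse of \<open>linear_form\<close>.\<close>

definition linear_part :: "'v::finite cpoly \<Rightarrow> complex ^ 'v" where
  "linear_part p = (\<chi> j. coef p (Poly_Mapping.single j 1))"

lemma linear_part_add: "linear_part (p + q) = linear_part p + linear_part q"
  by (simp add: linear_part_def vec_eq_iff lookup_add)

lemma linear_part_zero: "linear_part 0 = 0"
  by (simp add: linear_part_def vec_eq_iff)

lemma linear_part_minus: "linear_part (- p) = - linear_part p"
  by (simp add: linear_part_def vec_eq_iff)

lemma linear_part_mult:
  "linear_part (p * q) = coef p 0 *s linear_part q + coef q 0 *s linear_part p"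
  by (simp add: linear_part_def vec_eq_iff lookup_times_single mult.commute del: One_nat_def)

lemma linear_part_linear_form: "linear_part (linear_form u) = u"
  by (simp add: linear_part_def vec_eq_iff lookup_linear_form_single del: One_nat_def)

lemma poly_ring_simps [simp]:
  "carrier poly_ring = UNIV" "add poly_ring = (+)" "mult poly_ring = (*)"
  "zero poly_ring = 0" "one poly_ring = 1"
  by (simp_all add: ring_of_type_algebra_def)

lemma cring_poly_ring: "cring (poly_ring :: 'v cpoly ring)"
  by (rule cring_from_type_algebra)

text \<open>If \<open>p\<close> has no constant term, the product rule gives
  \<open>linear_part (q * p) = coef q 0 *s linear_part p\<close>, so closure under multiplication
  reduces to closure of \<open>V\<close> under scalars.\<close>

lemma ideal_linear_part_subspace:
  assumes V: "vec.subspace V"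
  shows "ideal {p. coef p 0 = 0 \<and> linear_part p \<in> V} poly_ring" (is "ideal ?I ?R")
proof -
  interpret cring ?R by (rule cring_poly_ring)
  have minus: "inv\<^bsub>add_monoid ?R\<^esub> p = - p" for p
    using minus_equality[of "- p" p] by (simp add: a_inv_def)
  show ?thesis
  proof (rule idealI)
    show "subgroup ?I (add_monoid ?R)"
    proof (rule subgroup.intro)
      show "inv\<^bsub>add_monoid ?R\<^esub> p \<in> ?I" if "p \<in> ?I" for p
        using that unfolding minus by (simp add: linear_part_minus vec.subspace_neg[OF V])
    qed (auto simp: lookup_add linear_part_add linear_part_zero
        vec.subspace_add[OF V] vec.subspace_0[OF V])
  qed (auto simp: lookup_times_zero linear_part_mult vec.subspace_scale[OF V] ring_axioms)
qed

text \<open>With at least two variables, the product contains two factors vanishing at the origin,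
  so it vanishes there to second order.\<close>

lemma linear_part_prod_pvar:
  assumes "I \<noteq> {}" "\<And>j. I \<noteq> {j}"
  shows "coef (\<Prod>j\<in>I. pvar j) 0 = 0" "linear_part (\<Prod>j\<in>I. pvar j) = 0"
proof -
  obtain j k where jk: "j \<in> I" "k \<in> I - {j}" using assms by blast
  have "(\<Prod>j\<in>I. pvar j) = pvar j * (pvar k * (\<Prod>i\<in>I - {j} - {k}. pvar i))"
    using jk by (simp add: prod.remove[of I j] prod.remove[of "I - {j}" k])
  then show "coef (\<Prod>j\<in>I. pvar j) 0 = 0" "linear_part (\<Prod>j\<in>I. pvar j) = 0"
    by (simp_all add: lookup_times_zero linear_part_mult lookup_pvar_zero)
qed

text \<open>The polynomials without constant term and with linear part in a fixed subspace form an
  ideal; hence forming an ideal creates no new linear forms.\<close>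

lemma linear_form_in_sum_ideal_iff:
  fixes K :: "'v::finite set set" and V :: "(complex ^ 'v) set"
  assumes V: "vec.subspace V" and K: "{} \<in> K" "\<And>j. {j} \<in> K"
  shows "linear_form u \<in> SR_ideal K <+>\<^bsub>poly_ring\<^esub> (Idl\<^bsub>poly_ring\<^esub> (linear_form ` V)) \<longleftrightarrow> u \<in> V"
    (is "_ \<in> ?S <+>\<^bsub>?R\<^esub> ?J \<longleftrightarrow> _")
proof
  interpret cring ?R by (rule cring_poly_ring)
  let ?I = "{p. coef p 0 = 0 \<and> linear_part p \<in> V}"
  have "?S \<subseteq> ?I"
    unfolding SR_ideal_def
  proof (rule genideal_minimal[OF ideal_linear_part_subspace[OF V]], clarify)
    fix I assume "I \<notin> K"
    then have "I \<noteq> {}" "I \<noteq> {j}" for j using K by auto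
    then show "coef (\<Prod>j\<in>I. pvar j) 0 = 0 \<and> linear_part (\<Prod>j\<in>I. pvar j) \<in> V"
      using linear_part_prod_pvar vec.subspace_0[OF V] by metis
  qed
  moreover have "?J \<subseteq> ?I"
    by (rule genideal_minimal[OF ideal_linear_part_subspace[OF V]])
      (auto simp: lookup_linear_form_zero linear_part_linear_form)
  moreover assume "linear_form u \<in> ?S <+>\<^bsub>?R\<^esub> ?J"
  ultimately obtain p q where "linear_form u = p + q" "p \<in> ?I" "q \<in> ?I"
    unfolding set_add_def' by auto
  then have "linear_part (linear_form u) \<in> V"
    by (simp add: linear_part_add vec.subspace_add[OF V])
  then show "u \<in> V" by (simp add: linear_part_linear_form)
next
  interpret cring ?R by (rule cring_poly_ring)
  assume "u \<in> V"
  then have "linear_form u \<in> ?J" using genideal_self[of "linear_form ` V"] by auto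
  moreover have "0 \<in> ?S"
    unfolding SR_ideal_def
    using additive_subgroup.zero_closed[OF ideal.axioms(1)[OF genideal_ideal]] by simp
  ultimately show "linear_form u \<in> ?S <+>\<^bsub>?R\<^esub> ?J"
    unfolding set_add_def' by force
qed

section \<open>The ring and its part of bidegree (1,1)\<close>

lemma ideal_R_ideal: "ideal (R_ideal \<Lambda> vis a) poly_ring"
proof -
  interpret cring poly_ring by (rule cring_poly_ring)
  show ?thesis
    unfolding R_ideal_def SR_ideal_def J_ideal_def
    by (intro add_ideals genideal_ideal) auto
qed

lemma R_class_eq_iff:
  "R_class \<Lambda> vis a p = R_class \<Lambda> vis a q \<longleftrightarrow> p - q \<in> R_ideal \<Lambda> vis a"
proof -
  interpret cring poly_ring by (rule cring_poly_ring)
  interpret ideal "R_ideal \<Lambda> vis a" poly_ring by (rule ideal_R_ideal)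
  have "p \<ominus>\<^bsub>poly_ring\<^esub> q = p - q"
    using minus_equality[of "- q" q] by (simp add: a_minus_def)
  then show ?thesis
    using quotient_eq_iff_same_a_r_cos[OF ideal_R_ideal[of \<Lambda> vis a], of p q]
    by (simp add: R_class_def)
qed

lemma zero_R11: "\<zero>\<^bsub>R11 \<Lambda> vis a\<^esub> = R_class \<Lambda> vis a (linear_form 0)"
proof -
  interpret cring poly_ring by (rule cring_poly_ring)
  interpret ideal "R_ideal \<Lambda> vis a" poly_ring by (rule ideal_R_ideal)
  show ?thesis
    using a_rcos_const[OF zero_closed]
    by (simp add: R11_def R_class_def R_ring_def FactRing_def linear_form_zero)
qed

text \<open>Scaling in \<open>R11\<close> multiplies by the class of a constant polynomial, and a
  constant times a linear form is a linear form; thus \<open>R11\<close> is a linear image of the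
  space of coefficient vectors.\<close>

lemma
  shows module_R11: "module CC (R11 \<Lambda> vis a)"
    and R_class_linear_form_linear:
      "(\<lambda>u. R_class \<Lambda> vis a (linear_form u)) \<in> linear_maps (vec_module UNIV) (R11 \<Lambda> vis a)"
proof -
  interpret cring poly_ring by (rule cring_poly_ring)
  interpret ideal "R_ideal \<Lambda> vis a" poly_ring by (rule ideal_R_ideal)
  let ?p = "\<lambda>u. R_class \<Lambda> vis a (linear_form u)"
  have carrier: "carrier (R11 \<Lambda> vis a) = range ?p" by (simp add: R11_def)
  have add: "?p u \<oplus>\<^bsub>R11 \<Lambda> vis a\<^esub> ?p v = ?p (u + v)" for u v
    by (simp add: R11_def R_class_def R_ring_def FactRing_def a_rcos_sum linear_form_add)
  have smult: "c \<odot>\<^bsub>R11 \<Lambda> vis a\<^esub> ?p u = ?p (c *s u)" for c u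
    by (simp add: R11_def R_class_def R_ring_def FactRing_def rcoset_mult_add linear_form_scale)
  note image = module_linear_image[OF module_vec_module[OF vec.subspace_UNIV], of _ ?p,
      unfolded vec_module_simps, OF carrier zero_R11 add smult]
  show "module CC (R11 \<Lambda> vis a)" by (rule image)
  show "?p \<in> linear_maps (vec_module UNIV) (R11 \<Lambda> vis a)" by (rule image)
qed

section \<open>Convexity: indispensable labels and admissibility\<close>

lemma convex_hull_image_weights:
  fixes f :: "'i \<Rightarrow> 'a::real_vector"
  assumes "finite I" "y \<in> convex hull (f ` I)"
  shows "\<exists>t. (\<forall>i\<in>I. 0 \<le> t i) \<and> sum t I = 1 \<and> (\<Sum>i\<in>I. t i *\<^sub>R f i) = y"
proof -
  \<comment> \<open>Weights are attached to labels, not to points, because \<open>f\<close> may take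
    a value repeatedly. The points with such weights form a convex set containing the image.\<close>
  let ?C = "{y. \<exists>t. (\<forall>i\<in>I. 0 \<le> t i) \<and> sum t I = 1 \<and> (\<Sum>i\<in>I. t i *\<^sub>R f i) = y}"
  have "convex ?C"
  proof (rule convexI, clarsimp)
    fix t t' :: "'i \<Rightarrow> real" and u v :: real
    assume "0 \<le> u" "0 \<le> v" "u + v = 1" "\<forall>i\<in>I. 0 \<le> t i" "sum t I = 1" "\<forall>i\<in>I. 0 \<le> t' i" "sum t' I = 1"
    then show "\<exists>t''. (\<forall>i\<in>I. 0 \<le> t'' i) \<and> sum t'' I = 1 \<and>
      (\<Sum>i\<in>I. t'' i *\<^sub>R f i) = u *\<^sub>R (\<Sum>i\<in>I. t i *\<^sub>R f i) + v *\<^sub>R (\<Sum>i\<in>I. t' i *\<^sub>R f i)"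
      by (intro exI[of _ "\<lambda>i. u * t i + v * t' i"])
        (simp add: sum.distrib sum_distrib_left[symmetric] scaleR_sum_right scaleR_add_left)
  qed
  moreover have "f ` I \<subseteq> ?C"
  proof clarify
    fix i assume "i \<in> I"
    then show "\<exists>t. (\<forall>j\<in>I. 0 \<le> t j) \<and> sum t I = 1 \<and> (\<Sum>j\<in>I. t j *\<^sub>R f j) = f i"
      using assms(1) by (intro exI[of _ "\<lambda>j. if j = i then 1 else 0"])
        (auto simp: if_distrib[of "\<lambda>c. c *\<^sub>R _"] cong: if_cong)
  qed
  ultimately have "convex hull (f ` I) \<subseteq> ?C" by (simp add: hull_minimal)
  then show ?thesis using assms(2) by auto
qed

lemma not_indispensable_weights:
  fixes \<Lambda> :: "'n::finite \<Rightarrow> complex ^ 'm"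
  assumes "\<And>i. 0 \<le> t i" "sum t UNIV = 1" "(\<Sum>i\<in>UNIV. t i *\<^sub>R \<Lambda> i) = 0" "t k = 0"
  shows "\<not> indispensable \<Lambda> k"
proof -
  let ?I = "{i. i \<noteq> k}"
  have I: "?I = UNIV - {k}" by auto
  have "sum t ?I = 1" "(\<Sum>i\<in>?I. t i *\<^sub>R \<Lambda> i) = 0"
    using assms(2-4) by (simp_all add: I sum_diff1)
  moreover have "(\<Sum>i\<in>?I. t i *\<^sub>R \<Lambda> i) \<in> convex hull (\<Lambda> ` ?I)"
    using assms(1) \<open>sum t ?I = 1\<close> by (intro convex_sum) (auto intro: hull_inc)
  ultimately show ?thesis by (simp add: indispensable_def)
qed

text \<open>Moving the weights of a convex representation of \<open>0\<close> along an affine dependence of the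
  indispensable vectors, until the first weight vanishes, would make a label dispensable.\<close>

lemma indispensable_affine_independent:
  fixes \<Lambda> :: "'n::finite \<Rightarrow> complex ^ 'm" and c :: "'n \<Rightarrow> real"
  assumes hull: "0 \<in> convex hull range \<Lambda>"
    and supp: "\<And>i. c i \<noteq> 0 \<Longrightarrow> indispensable \<Lambda> i"
    and sum0: "sum c UNIV = 0" and dep: "(\<Sum>i\<in>UNIV. c i *\<^sub>R \<Lambda> i) = 0"
  shows "c i = 0"
proof (rule ccontr)
  assume "c i \<noteq> 0"
  obtain t where t: "\<And>i. 0 \<le> t i" "sum t UNIV = 1" "(\<Sum>i\<in>UNIV. t i *\<^sub>R \<Lambda> i) = 0"
    using convex_hull_image_weights[OF finite hull] by auto
  define Neg where "Neg = {j. c j < 0}"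
  \<comment> \<open>Coefficients with sum \<open>0\<close> that do not all vanish include a negative
    one, so the minimum below is over a nonempty set.\<close>
  have "Neg \<noteq> {}"
  proof
    assume "Neg = {}"
    then have "\<forall>j\<in>UNIV. c j = 0"
      using sum_nonneg_eq_0_iff[of UNIV c] sum0 by (auto simp: Neg_def not_less)
    then show False using \<open>c i \<noteq> 0\<close> by simp
  qed
  define s where "s = Min ((\<lambda>j. t j / - c j) ` Neg)"
  have "s \<in> (\<lambda>j. t j / - c j) ` Neg"
    unfolding s_def using \<open>Neg \<noteq> {}\<close> by (intro Min_in) auto
  then obtain k where k: "c k < 0" "s = t k / - c k" by (auto simp: Neg_def)
  have "0 \<le> s" unfolding k(2) using k(1) t(1) by (intro divide_nonneg_pos) auto
  have "(\<Sum>j\<in>UNIV. (t j + s * c j) *\<^sub>R \<Lambda> j) =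
      (\<Sum>j\<in>UNIV. t j *\<^sub>R \<Lambda> j) + s *\<^sub>R (\<Sum>j\<in>UNIV. c j *\<^sub>R \<Lambda> j)"
    by (simp add: scaleR_add_left sum.distrib scaleR_sum_right)
  then have S: "(\<Sum>j\<in>UNIV. (t j + s * c j) *\<^sub>R \<Lambda> j) = 0"
    using t(3) dep by simp
  have "0 \<le> t j + s * c j" for j
  proof (cases "c j < 0")
    case True
    then have "s \<le> t j / - c j" unfolding s_def by (intro Min_le) (auto simp: Neg_def)
    then show ?thesis using True by (simp add: field_simps)
  next
    case False
    then show ?thesis using \<open>0 \<le> s\<close> t(1)[of j] by simp
  qed
  moreover have "(\<Sum>j\<in>UNIV. t j + s * c j) = 1"
    using t(2) sum0 by (simp add: sum.distrib sum_distrib_left[symmetric])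
  moreover note S
  moreover have "t k + s * c k = 0" using k by (simp add: field_simps)
  ultimately have "\<not> indispensable \<Lambda> k" by (rule not_indispensable_weights)
  then show False using supp[of k] k by simp
qed

text \<open>Coefficients of the family become coefficients on all labels, extended by
  \<open>0\<close> outside the range of the injection \<open>a\<close>.\<close>

lemma indispensable_family_affine_independent:
  fixes \<Lambda> :: "'n::finite \<Rightarrow> complex ^ 'm" and r :: "'k::finite \<Rightarrow> real"
  assumes hull: "0 \<in> convex hull range \<Lambda>"
    and a: "inj a" "\<And>k. indispensable \<Lambda> (a k)"
    and sum0: "sum r UNIV = 0" and dep: "(\<Sum>k\<in>UNIV. r k *\<^sub>R \<Lambda> (a k)) = 0"
  shows "r k = 0"
proof -
  define c where "c i = (if i \<in> range a then r (inv_into UNIV a i) else 0)" for i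
  have "sum c UNIV = sum c (range a)"
    by (intro sum.mono_neutral_right) (auto simp: c_def)
  also have "\<dots> = sum r UNIV"
    using a(1) by (simp add: sum.reindex c_def)
  finally have 1: "sum c UNIV = 0" using sum0 by simp
  have "(\<Sum>i\<in>UNIV. c i *\<^sub>R \<Lambda> i) = (\<Sum>i\<in>range a. c i *\<^sub>R \<Lambda> i)"
    by (intro sum.mono_neutral_right) (auto simp: c_def)
  also have "\<dots> = (\<Sum>k\<in>UNIV. r k *\<^sub>R \<Lambda> (a k))"
    using a(1) by (simp add: sum.reindex c_def)
  finally have 2: "(\<Sum>i\<in>UNIV. c i *\<^sub>R \<Lambda> i) = 0" using dep by simp
  have "c (a k) = 0"
    by (rule indispensable_affine_independent[OF hull _ 1 2]) (auto simp: c_def a(2) split: if_splits)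
  then show ?thesis using a(1) by (simp add: c_def)
qed

text \<open>Giving the label \<open>a None\<close> the coefficient \<open>- sum r UNIV\<close> turns
  a real dependence between the rows of \<open>block_B\<close>, which are differences of vectors,
  into an affine dependence of the indispensable vectors.\<close>

lemma real_covector_eq_0:
  fixes \<Lambda> :: "'n::finite \<Rightarrow> complex ^ 'm::finite" and a :: "'m option \<Rightarrow> 'n"
  assumes hull: "0 \<in> convex hull range \<Lambda>"
    and a: "inj a" "\<And>k. indispensable \<Lambda> (a k)"
    and r: "transpose (block_B \<Lambda> a) *v (\<chi> \<mu>. complex_of_real (r \<mu>)) = 0"
  shows "r \<mu> = 0"
proof -
  define r' where "r' k = (case k of None \<Rightarrow> - sum r UNIV | Some \<mu> \<Rightarrow> r \<mu>)" for k
  have opt: "sum f UNIV = f None + (\<Sum>\<mu>\<in>UNIV. f (Some \<mu>))" for f :: "'m option \<Rightarrow> 'z::comm_monoid_add"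
    by (simp add: UNIV_option_conv sum.reindex)
  have "sum r' UNIV = 0" by (simp add: opt r'_def)
  moreover have "(\<Sum>k\<in>UNIV. r' k *\<^sub>R \<Lambda> (a k)) = 0"
  proof -
    have "(\<Sum>k\<in>UNIV. r' k *\<^sub>R \<Lambda> (a k)) = (\<Sum>\<mu>\<in>UNIV. r \<mu> *\<^sub>R (\<Lambda> (a (Some \<mu>)) - \<Lambda> (a None)))"
      by (simp add: opt r'_def scaleR_diff_right sum_subtractf scaleR_sum_left)
    also have "\<dots> = transpose (block_B \<Lambda> a) *v (\<chi> \<mu>. complex_of_real (r \<mu>))"
      by (simp add: vec_eq_iff matrix_vector_mult_def transpose_def block_B_def
          del: transpose_matrix_vector) (simp add: scaleR_conv_of_real mult.commute)
    finally show ?thesis using r by simp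
  qed
  ultimately have "r' (Some \<mu>) = 0"
    by (rule indispensable_family_affine_independent[OF hull a])
  then show ?thesis by (simp add: r'_def)
qed

text \<open>The real and imaginary parts are complex combinations of \<eta> and its conjugate, so
  the dual map kills both, and the real case applies to each.\<close>

lemma covector_eq_0:
  fixes \<Lambda> :: "'n::finite \<Rightarrow> complex ^ 'm::finite" and a :: "'m option \<Rightarrow> 'n"
  assumes hull: "0 \<in> convex hull range \<Lambda>"
    and a: "inj a" "\<And>k. indispensable \<Lambda> (a k)"
    and eta: "transpose (block_B \<Lambda> a) *v \<eta> = 0" "transpose (block_B \<Lambda> a) *v (\<chi> \<mu>. cnj (\<eta> $ \<mu>)) = 0"
  shows "\<eta> = 0"
proof -
  have "(\<chi> \<mu>. complex_of_real (Re (\<eta> $ \<mu>))) = (1/2) *s (\<eta> + (\<chi> \<mu>. cnj (\<eta> $ \<mu>)))"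
    "(\<chi> \<mu>. complex_of_real (Im (\<eta> $ \<mu>))) = (1/(2*\<i>)) *s (\<eta> - (\<chi> \<mu>. cnj (\<eta> $ \<mu>)))"
    by (simp_all add: vec_eq_iff complex_eq_iff)
  then have "transpose (block_B \<Lambda> a) *v (\<chi> \<mu>. complex_of_real (Re (\<eta> $ \<mu>))) = 0"
    "transpose (block_B \<Lambda> a) *v (\<chi> \<mu>. complex_of_real (Im (\<eta> $ \<mu>))) = 0"
    by (simp_all only: vector_scalar_commute matrix_vector_right_distrib
        matrix_vector_mult_diff_distrib eta) simp_all
  from this[THEN real_covector_eq_0[OF hull a]] show ?thesis
    by (simp add: vec_eq_iff complex_eq_iff)
qed

lemma admissible_no_common_zero:
  fixes \<Lambda> :: "'n::finite \<Rightarrow> complex ^ 'm::finite"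
  assumes adm: "admissible \<Lambda>" and T: "\<And>i. pairing (\<Lambda> i - \<Lambda> k) T = 0"
  shows "T = 0"
proof (rule ccontr)
  assume "T \<noteq> 0"
  have hull: "0 \<in> convex hull range \<Lambda>" using adm by (simp add: admissible_def)
  obtain t where t: "\<And>i. 0 \<le> t i" "sum t UNIV = 1" "(\<Sum>i\<in>UNIV. t i *\<^sub>R \<Lambda> i) = 0"
    using convex_hull_image_weights[OF finite hull] by auto
  \<comment> \<open>Conjugation makes the real inner product with \<open>z\<close> the real part of
    the bilinear pairing with \<open>T\<close>.\<close>
  define z where "z = (\<chi> \<mu>. cnj (T $ \<mu>))"
  have z: "inner z x = Re (pairing x T)" for x
    by (simp add: z_def inner_vec_def pairing_def inner_complex_def mult.commute)
  have "z \<noteq> 0" using \<open>T \<noteq> 0\<close> by (simp add: z_def vec_eq_iff)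
  have eq: "inner z (\<Lambda> i) = inner z (\<Lambda> k)" for i
    using T[of i] by (simp add: z pairing_diff_left)
  \<comment> \<open>All vectors lie in one level set of the functional; a convex combination equal
    to \<open>0\<close> forces the level to be \<open>0\<close>, so the hyperplane passes through
    the origin.\<close>
  have "0 = inner z (\<Sum>i\<in>UNIV. t i *\<^sub>R \<Lambda> i)" using t(3) by simp
  also have "\<dots> = (\<Sum>i\<in>UNIV. t i * inner z (\<Lambda> k))"
    unfolding inner_sum_right inner_scaleR_right by (intro sum.cong refl arg_cong[of _ _ "(*) _"] eq)
  also have "\<dots> = inner z (\<Lambda> k)" by (simp add: sum_distrib_right[symmetric] t(2))
  finally have "inner z (\<Lambda> i) = 0" for i using eq[of i] by simp
  then have "range \<Lambda> \<subseteq> {x. inner z x = 0}" by auto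
  \<comment> \<open>The real dimension is \<open>2 * CARD('m)\<close> and a hyperplane has one less,
    so Caratheodory's theorem needs at most \<open>2 * CARD('m)\<close> points.\<close>
  from aff_dim_subset[OF this] have dim: "aff_dim (range \<Lambda>) + 1 \<le> 2 * int CARD('m)"
    using aff_dim_hyperplane[OF \<open>z \<noteq> 0\<close>, of 0] by simp
  obtain S where S: "finite S" "S \<subseteq> range \<Lambda>" "int (card S) \<le> aff_dim (range \<Lambda>) + 1" "0 \<in> convex hull S"
    using hull unfolding caratheodory_aff_dim[of "range \<Lambda>"] by auto
  \<comment> \<open>Admissibility counts labels, not points, so one label is chosen for each point
    of \<open>S\<close>.\<close>
  obtain I where I: "inj_on \<Lambda> I" "S = \<Lambda> ` I"
    using S(2) by (auto simp: subset_image_inj)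
  have "card I = card S" using I by (simp add: card_image)
  moreover have "S \<noteq> {}" using S(4) by auto
  ultimately have "1 \<le> card I" "card I \<le> 2 * CARD('m)"
    using S(1,3) dim by (auto simp: Suc_le_eq card_gt_0_iff)
  then show False using adm S(4) I(2) by (auto simp: admissible_def)
qed

section \<open>Annihilators of the blocks and relations in degree one\<close>

lemma join_add: "join u \<eta> + join v \<theta> = join (u + v) (\<eta> + \<theta>)"
  and join_diff: "join u \<eta> - join v \<theta> = join (u - v) (\<eta> - \<theta>)"
  and join_scale: "c *s join u \<eta> = join (c *s u) (c *s \<eta>)"
  by (simp_all add: join_def vec_eq_iff split: sum.split)

lemma join_zero: "join 0 0 = 0"
  by (simp add: join_def vec_eq_iff split: sum.split)

lemma join_cases:
  obtains u \<eta> where "w = join u \<eta>"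
proof
  show "w = join (\<chi> j. w $ Inl j) (\<chi> \<mu>. w $ Inr \<mu>)"
    by (simp add: join_def vec_eq_iff split: sum.split)
qed

lemma pairing_join:
  fixes u x :: "complex ^ 'v::finite" and \<eta> y :: "complex ^ 'm::finite"
  shows "pairing (join u \<eta>) (join x y) = pairing u x + pairing \<eta> y"
proof -
  have "pairing (join u \<eta>) (join x y) = (\<Sum>i\<in>UNIV <+> UNIV. join u \<eta> $ i * join x y $ i)"
    by (simp add: pairing_def UNIV_Plus_UNIV)
  also have "\<dots> = pairing u x + pairing \<eta> y"
    by (subst sum.Plus) (simp_all add: pairing_def join_def)
  finally show ?thesis .
qed

lemma join_in_Ann_h_space_iff:
  fixes vis :: "'v::finite \<Rightarrow> 'n::finite" and a :: "'m::finite option \<Rightarrow> 'n"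
  shows "join u \<eta> \<in> Ann (h_space \<Lambda> vis a) \<longleftrightarrow>
    transpose (block_A \<Lambda> vis a) *v u + transpose (block_B \<Lambda> a) *v \<eta> = 0"
proof -
  have "join u \<eta> \<in> Ann (h_space \<Lambda> vis a) \<longleftrightarrow>
      (\<forall>T. pairing (transpose (block_A \<Lambda> vis a) *v u + transpose (block_B \<Lambda> a) *v \<eta>) T = 0)"
    by (simp add: Ann_def h_space_def pairing_join pairing_add_left pairing_transpose
        del: transpose_matrix_vector)
  then show ?thesis by (simp only: pairing_left_eq_0_iff)
qed

lemma Ann_sum:
  assumes "0 \<in> S" "0 \<in> S'"
  shows "Ann {x + y | x y. x \<in> S \<and> y \<in> S'} = Ann S \<inter> Ann S'"
proof -
  have "x \<in> {x + y | x y. x \<in> S \<and> y \<in> S'}" if "x \<in> S" for x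
    using that assms(2) by simp (metis add_0_right)
  moreover have "y \<in> {x + y | x y. x \<in> S \<and> y \<in> S'}" if "y \<in> S'" for y
    using that assms(1) by simp (metis add_0_left)
  ultimately show ?thesis
    by (auto simp: Ann_def pairing_add_right)
qed

lemma Ann_conj_set: "w \<in> Ann (conj_set S) \<longleftrightarrow> (\<chi> i. cnj (w $ i)) \<in> Ann S"
proof -
  have "pairing w (\<chi> i. cnj (x $ i)) = cnj (pairing (\<chi> i. cnj (w $ i)) x)" for x
    by (simp add: pairing_def)
  then show ?thesis by (simp add: Ann_def conj_set_def)
qed

lemma zero_in_h_space: "0 \<in> h_space \<Lambda> vis a"
  unfolding h_space_def by (rule range_eqI[of _ _ 0]) (simp add: join_zero)

text \<open>Annihilating a sum means annihilating both summands, and annihilating the conjugate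
  space means that the conjugate covector annihilates the space; so \<open>L_space\<close> is the
  largest conjugation-stable part of the annihilator of \<open>h_space\<close>.\<close>

lemma L_space_iff:
  "w \<in> L_space \<Lambda> vis a \<longleftrightarrow>
     w \<in> Ann (h_space \<Lambda> vis a) \<and> (\<chi> i. cnj (w $ i)) \<in> Ann (h_space \<Lambda> vis a)"
proof -
  have "(\<chi> i. cnj ((0 :: complex ^ _) $ i)) \<in> conj_set (h_space \<Lambda> vis a)"
    unfolding conj_set_def by (rule imageI) (rule zero_in_h_space)
  then have "0 \<in> conj_set (h_space \<Lambda> vis a)" by (simp add: zero_vec_def)
  then show ?thesis
    unfolding L_space_def Ann_sum[OF zero_in_h_space \<open>0 \<in> conj_set _\<close>] by (simp add: Ann_conj_set)
qed

lemma subspace_L_space: "vec.subspace (L_space \<Lambda> vis a)"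
  unfolding L_space_def by (rule subspace_Ann)

text \<open>The coefficient vectors of the linear generators of \<open>J_ideal\<close>; it stands
  for the degree-one piece of that ideal.\<close>

definition L_first :: "('n::finite \<Rightarrow> complex ^ 'm) \<Rightarrow> ('v::finite \<Rightarrow> 'n) \<Rightarrow> ('m option \<Rightarrow> 'n) \<Rightarrow> (complex ^ 'v) set"
  where "L_first \<Lambda> vis a = {u. \<exists>\<eta>. join u \<eta> \<in> L_space \<Lambda> vis a}"

lemma subspace_L_first: "vec.subspace (L_first \<Lambda> vis a)"
proof -
  note L = subspace_L_space[of \<Lambda> vis a]
  show ?thesis
    unfolding vec.subspace_def L_first_def
    using vec.subspace_0[OF L] vec.subspace_add[OF L] vec.subspace_scale[OF L]
    by (auto simp: join_zero[symmetric]) (metis join_add, metis join_scale)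
qed

text \<open>That a singleton is a face is exactly the visibility of its label, and the empty face is
  the hull condition of admissibility.\<close>

lemma visible_complex_vertices:
  assumes "0 \<in> convex hull range \<Lambda>" "\<And>j. \<not> indispensable \<Lambda> (vis j)"
  shows "{} \<in> visible_complex \<Lambda> vis" "{j} \<in> visible_complex \<Lambda> vis"
  using assms by (auto simp: visible_complex_def indispensable_def)

text \<open>The Stanley-Reisner generators contribute nothing in degree one, so \<open>R11\<close>
  is the space of coefficient vectors modulo \<open>L_first\<close>.\<close>

lemma R_class_linear_form_eq_iff:
  assumes "0 \<in> convex hull range \<Lambda>" "\<And>j. \<not> indispensable \<Lambda> (vis j)"
  shows "R_class \<Lambda> vis a (linear_form u) = R_class \<Lambda> vis a (linear_form v) \<longleftrightarrow>
    u - v \<in> L_first \<Lambda> vis a"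
proof -
  have "{linear_form u | u \<eta>. join u \<eta> \<in> L_space \<Lambda> vis a} = linear_form ` L_first \<Lambda> vis a"
    by (auto simp: L_first_def)
  then show ?thesis
    unfolding R_class_eq_iff linear_form_diff[symmetric] R_ideal_def J_ideal_def
    using linear_form_in_sum_ideal_iff[OF subspace_L_first visible_complex_vertices[OF assms]]
    by simp
qed

section \<open>The exact sequence\<close>

theorem theorem10p3:
  fixes \<Lambda> :: "'n::finite \<Rightarrow> complex ^ 'm::finite"
    and vis :: "'v::finite \<Rightarrow> 'n"
    and a :: "'m option \<Rightarrow> 'n"
  assumes "admissible \<Lambda>"
    and "minimally_stable \<Lambda>"
    and "labelling \<Lambda> vis a"
    and "polytopal \<Lambda> vis"
    and "lvm_dim \<Lambda> \<ge> 1"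
  defines "A \<equiv> block_A \<Lambda> vis a"
    and "B \<equiv> block_B \<Lambda> a"
  shows
    "coker_functional B \<in> linear_isos (vec_module (mat_ker (transpose B))) (dual_module (coker B)) \<and>
     (\<exists>\<iota> c \<beta>.
        (\<forall>\<eta>\<in>mat_ker (transpose B). \<iota> (coker_functional B \<eta>) = W_class \<Lambda> vis a 0 \<eta>) \<and>
        (\<forall>u \<eta>. join u \<eta> \<in> Ann (h_space \<Lambda> vis a) \<longrightarrow>
           c (W_class \<Lambda> vis a u \<eta>) = R_class \<Lambda> vis a (linear_form u)) \<and>
        (\<forall>u. \<beta> (R_class \<Lambda> vis a (linear_form u)) =
           (\<lambda>T\<in>mat_ker B. pairing (transpose A *v u) T)) \<and>
        exact_sequence4 (dual_module (coker B)) \<iota> (W10 \<Lambda> vis a) c (R11 \<Lambda> vis a) \<beta>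
          (dual_module (vec_module (mat_ker B))))"
proof (rule conjI)
  let ?KT = "mat_ker (transpose B)" and ?h = "Ann (h_space \<Lambda> vis a)" and ?L = "L_space \<Lambda> vis a"
  let ?R = "\<lambda>u. R_class \<Lambda> vis a (linear_form u)"
  let ?W = "\<lambda>w. ?L +>\<^bsub>vec_module ?h\<^esub> w"
  let ?dK = "dual_module (vec_module (mat_ker B))"
  have hull: "0 \<in> convex hull range \<Lambda>" using assms(1) by (simp add: admissible_def)
  have vis: "\<not> indispensable \<Lambda> (vis j)" for j
    using assms(3) by (auto simp: labelling_def bij_betw_def)
  have a: "inj a" "indispensable \<Lambda> (a k)" for k
    using assms(3) by (auto simp: labelling_def bij_betw_def)
  have labels: "i \<in> range vis \<union> range a" for i
    using assms(3) by (auto simp: labelling_def bij_betw_def)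
  note R_eq = R_class_linear_form_eq_iff[where a = a, OF hull vis]
  note W_eq = coset_vec_module_eq_iff[OF subspace_L_space]
  have L_sub: "?L \<subseteq> ?h" by (auto simp: L_space_iff)
  have Ann_iff: "join u \<eta> \<in> ?h \<longleftrightarrow> transpose A *v u + transpose B *v \<eta> = 0" for u \<eta>
    unfolding A_def B_def by (rule join_in_Ann_h_space_iff)
  have h0: "join 0 \<eta> \<in> ?h \<longleftrightarrow> \<eta> \<in> ?KT" for \<eta>
    by (simp add: Ann_iff mat_ker_def)
  have iso: "coker_functional B \<in> linear_isos (vec_module ?KT) (dual_module (coker B))"
    by (rule coker_functional_linear_iso)
  then show "coker_functional B \<in> linear_isos (vec_module ?KT) (dual_module (coker B))" .
  have iso_lin: "coker_functional B \<in> linear_maps (vec_module ?KT) (dual_module (coker B))"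
    and iso_inj: "inj_on (coker_functional B) ?KT"
    and iso_surj: "coker_functional B ` ?KT = carrier (dual_module (coker B))"
    using iso by (simp_all add: linear_isos_def bij_betw_def)

  have J_join: "\<exists>\<eta>. join u \<eta> \<in> ?h" if "u \<in> L_first \<Lambda> vis a" for u
    using that L_sub by (auto simp: L_first_def)
  let ?b = "\<lambda>u. \<lambda>T\<in>mat_ker B. pairing (transpose A *v u) T"
  have b_eq_iff: "?b u = ?b v \<longleftrightarrow> (\<forall>T\<in>mat_ker B. pairing (transpose A *v (u - v)) T = 0)" for u v
    by (auto simp: restrict_def fun_eq_iff matrix_vector_mult_diff_distrib pairing_diff_left
        simp del: transpose_matrix_vector)
  \<comment> \<open>Both sides say that \<open>transpose A *v u\<close> lies in the range of the
    dual of \<open>B\<close>: the left one by duality, the right one by \<open>Ann_iff\<close>, up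
    to the sign of \<eta>.\<close>
  have b_zero_iff: "(\<forall>T\<in>mat_ker B. pairing (transpose A *v u) T = 0) \<longleftrightarrow> (\<exists>\<eta>. join u \<eta> \<in> ?h)" for u
  proof
    assume "\<forall>T\<in>mat_ker B. pairing (transpose A *v u) T = 0"
    then obtain \<eta> where "transpose A *v u = transpose B *v \<eta>"
      using in_range_transposeI[of B] by blast
    moreover have "transpose B *v (- \<eta>) = - (transpose B *v \<eta>)"
      using matrix_vector_mult_diff_distrib[of "transpose B" 0 \<eta>] by simp
    ultimately have "join u (- \<eta>) \<in> ?h" unfolding Ann_iff by simp
    then show "\<exists>\<eta>. join u \<eta> \<in> ?h" ..
  next
    assume "\<exists>\<eta>. join u \<eta> \<in> ?h"
    then obtain \<eta> where "transpose A *v u + transpose B *v \<eta> = 0" unfolding Ann_iff by blast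
    then have "pairing (transpose A *v u + transpose B *v \<eta>) T = 0" for T
      by (simp only: pairing_zero_left)
    from this[unfolded pairing_add_left pairing_transpose]
    have "pairing u (A *v T) = 0" if "T \<in> mat_ker B" for T
      using that by (metis (mono_tags, lifting) add_0_right mat_ker_def mem_Collect_eq pairing_zero_right)
    then show "\<forall>T\<in>mat_ker B. pairing (transpose A *v u) T = 0"
      by (simp add: pairing_transpose del: transpose_matrix_vector)
  qed

  \<comment> \<open>Injectivity of the identification with the dual of the cokernel makes this
    prescription consistent.\<close>
  obtain \<iota> where \<iota>: "\<And>\<eta>. \<eta> \<in> ?KT \<Longrightarrow> \<iota> (coker_functional B \<eta>) = ?W (join 0 \<eta>)"
    using ex_factor[of ?KT "coker_functional B" "\<lambda>\<eta>. ?W (join 0 \<eta>)"] iso_inj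
    by (metis inj_onD)
  \<comment> \<open>The first block of a covector, read in \<open>R11\<close>; \<open>c\<close> is
    this map passed to classes.\<close>
  let ?q = "\<lambda>w :: complex ^ ('v + 'm). ?R (\<chi> j. w $ Inl j)"
  have q_join: "?q (join u \<eta>) = ?R u" for u \<eta>
  proof -
    have "(\<chi> j. join u \<eta> $ Inl j) = u" by (simp add: join_def vec_eq_iff)
    then show ?thesis by simp
  qed
  have "\<exists>c. \<forall>w\<in>?h. c (?W w) = ?q w"
  proof (rule ex_factor)
    fix w w' assume W: "?W w = ?W w'"
    obtain u \<eta> v \<theta> where w: "w = join u \<eta>" "w' = join v \<theta>" by (metis join_cases)
    \<comment> \<open>Covectors with the same class differ by an element of \<open>L_space\<close>,
      whose first block is a relation in the ring.\<close>
    have "u - v \<in> L_first \<Lambda> vis a"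
      using W unfolding w W_eq join_diff L_first_def by blast
    then show "?q w = ?q w'" unfolding w q_join R_eq .
  qed
  then obtain c where c: "\<And>u \<eta>. join u \<eta> \<in> ?h \<Longrightarrow> c (?W (join u \<eta>)) = ?R u"
    using q_join by metis
  have "\<exists>\<beta>. \<forall>u\<in>UNIV. \<beta> (?R u) = ?b u"
  proof (rule ex_factor)
    fix u v assume "?R u = ?R v"
    then have "u - v \<in> L_first \<Lambda> vis a" unfolding R_eq .
    \<comment> \<open>A relation \<open>u - v\<close> extends to a covector in
      \<open>L_space\<close>, which annihilates \<open>h_space\<close>; hence its image under the
      dual of \<open>A\<close> vanishes on the kernel of \<open>B\<close>.\<close>
    from J_join[OF this] show "?b u = ?b v" unfolding b_eq_iff b_zero_iff .
  qed
  then obtain \<beta> where \<beta>: "\<And>u. \<beta> (?R u) = ?b u" by blast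

  note mod_vec = module_vec_module[OF vec.subspace_UNIV] module_vec_module[OF subspace_mat_ker]
    module_vec_module[OF subspace_Ann]
  have M1: "module CC (dual_module (coker B))"
    unfolding coker_def
    by (intro module_dual_module module_quot_vec_module vec.subspace_UNIV subspace_range_mult)
  have M2: "module CC (W10 \<Lambda> vis a)"
    unfolding W10_def by (intro module_quot_vec_module subspace_Ann subspace_L_space)
  have M4: "module CC ?dK"
    by (intro module_dual_module module_vec_module subspace_mat_ker)
  have W_lin: "?W \<in> linear_maps (vec_module ?h) (W10 \<Lambda> vis a)"
    unfolding W10_def by (rule coset_linear_map[OF subspace_Ann subspace_L_space])
  have W_car: "carrier (W10 \<Lambda> vis a) = ?W ` ?h"
    unfolding W10_def by (rule carrier_quot_vec_module)
  have W_zero: "\<zero>\<^bsub>W10 \<Lambda> vis a\<^esub> = ?W 0"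
    by (simp add: W10_def quot_module_def coset_vec_module)
  have R_lin: "?R \<in> linear_maps (vec_module UNIV) (R11 \<Lambda> vis a)"
    by (rule R_class_linear_form_linear)
  have R_car: "carrier (R11 \<Lambda> vis a) = range ?R" by (simp add: R11_def)
  note R_zero = zero_R11[of \<Lambda> vis a]

  have \<iota>_lin: "\<iota> \<in> linear_maps (dual_module (coker B)) (W10 \<Lambda> vis a)"
  proof (rule linear_maps_factor[OF mod_vec(2) iso_lin])
    show "coker_functional B ` carrier (vec_module ?KT) = carrier (dual_module (coker B))"
      using iso_surj by simp
    show "(\<lambda>\<eta>. ?W (join 0 \<eta>)) \<in> linear_maps (vec_module ?KT) (W10 \<Lambda> vis a)"
    proof -
      have "join (0 :: complex ^ 'v) (\<eta> + \<theta>) = join 0 \<eta> + join 0 \<theta>"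
        "join (0 :: complex ^ 'v) (k *s \<eta>) = k *s join 0 \<eta>" for \<eta> \<theta> :: "complex ^ 'm" and k
        by (simp_all add: join_add join_scale)
      then show ?thesis
        using W_lin unfolding linear_maps_def by (simp add: Pi_iff h0)
    qed
  qed (simp add: \<iota>)
  have c_lin: "c \<in> linear_maps (W10 \<Lambda> vis a) (R11 \<Lambda> vis a)"
  proof (rule linear_maps_factor[OF mod_vec(3) W_lin])
    show "?q \<in> linear_maps (vec_module ?h) (R11 \<Lambda> vis a)"
    proof -
      have "(\<chi> j. (w + w') $ Inl j) = (\<chi> j. w $ Inl j) + (\<chi> j. w' $ Inl j)"
        "(\<chi> j. (k *s w) $ Inl j) = k *s (\<chi> j. w $ Inl j)" for w w' :: "complex ^ ('v + 'm)" and k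
        by (simp_all add: vec_eq_iff)
      then show ?thesis
        using R_lin unfolding linear_maps_def by (simp add: Pi_iff)
    qed
    show "c (?W w) = ?q w" if "w \<in> carrier (vec_module ?h)" for w
      using that c by (cases w rule: join_cases) (simp only: q_join vec_module_simps)
  qed (simp add: W_car)
  have \<beta>_lin: "\<beta> \<in> linear_maps (R11 \<Lambda> vis a) ?dK"
  proof (rule linear_maps_factor[OF mod_vec(1) R_lin])
    show "?b \<in> linear_maps (vec_module UNIV) ?dK"
      by (auto simp: linear_maps_def[of "vec_module UNIV"] linear_maps_scalar_iff
          matrix_vector_right_distrib vector_scalar_commute
          pairing_add_left pairing_scale_left pairing_add_right pairing_scale_right
          vec.subspace_add[OF subspace_mat_ker] vec.subspace_scale[OF subspace_mat_ker]
          simp del: transpose_matrix_vector)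
  qed (simp_all add: R_car \<beta> del: dual_module_simps)

  have \<iota>_inj: "inj_on \<iota> (carrier (dual_module (coker B)))"
    unfolding iso_surj[symmetric]
  proof (rule inj_onI, clarify)
    fix \<eta> \<theta> assume h: "\<eta> \<in> ?KT" "\<theta> \<in> ?KT" "\<iota> (coker_functional B \<eta>) = \<iota> (coker_functional B \<theta>)"
    let ?d = "\<eta> - \<theta>"
    have "join 0 ?d \<in> ?L" using h by (simp add: \<iota> W_eq join_diff)
    moreover have "(\<chi> i. cnj (join (0 :: complex ^ 'v) ?d $ i)) = join 0 (\<chi> \<mu>. cnj (?d $ \<mu>))"
      by (simp add: join_def vec_eq_iff split: sum.split)
    \<comment> \<open>Membership in \<open>L_space\<close> asks that both \<open>join 0 ?d\<close>
      and its conjugate annihilate \<open>h_space\<close>; with first block \<open>0\<close>, each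
      condition concerns the dual of \<open>B\<close> alone.\<close>
    ultimately have "?d \<in> ?KT" "(\<chi> \<mu>. cnj (?d $ \<mu>)) \<in> ?KT"
      by (simp_all only: L_space_iff h0)
    then have "?d = 0"
      unfolding mat_ker_def B_def mem_Collect_eq by (rule covector_eq_0[OF hull a])
    then show "coker_functional B \<eta> = coker_functional B \<theta>" by simp
  qed

  have exact_W: "\<iota> ` carrier (dual_module (coker B)) =
      {x \<in> carrier (W10 \<Lambda> vis a). c x = \<zero>\<^bsub>R11 \<Lambda> vis a\<^esub>}"
  proof (intro equalityI subsetI)
    fix x assume "x \<in> \<iota> ` carrier (dual_module (coker B))"
    then obtain \<eta> where "\<eta> \<in> ?KT" "x = ?W (join 0 \<eta>)"
      unfolding iso_surj[symmetric] using \<iota> by auto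
    then show "x \<in> {x \<in> carrier (W10 \<Lambda> vis a). c x = \<zero>\<^bsub>R11 \<Lambda> vis a\<^esub>}"
      using h0 c by (auto simp: W_car R_zero)
  next
    fix x assume "x \<in> {x \<in> carrier (W10 \<Lambda> vis a). c x = \<zero>\<^bsub>R11 \<Lambda> vis a\<^esub>}"
    then obtain w where w: "w \<in> ?h" "x = ?W w" "c x = ?R 0" by (auto simp: W_car R_zero)
    obtain u \<eta> where u: "w = join u \<eta>" by (rule join_cases)
    have "?R u = ?R 0" using w u c by simp
    \<comment> \<open>A first block that vanishes in the ring lifts to some
      \<open>join u \<theta>\<close> in \<open>L_space\<close>; subtracting it leaves the class
      unchanged and clears the first block.\<close>
    then obtain \<theta> where \<theta>: "join u \<theta> \<in> ?L" unfolding R_eq by (auto simp: L_first_def)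
    have "join u \<eta> - join u \<theta> \<in> ?h"
      using w(1) \<theta> L_sub unfolding u by (intro vec.subspace_diff[OF subspace_Ann]) auto
    then have "\<eta> - \<theta> \<in> ?KT" by (simp add: join_diff h0)
    moreover have "x = ?W (join 0 (\<eta> - \<theta>))"
      using \<theta> unfolding w(2) u W_eq by (simp add: join_diff)
    ultimately show "x \<in> \<iota> ` carrier (dual_module (coker B))"
      unfolding iso_surj[symmetric] image_image using \<iota> by (intro image_eqI[of _ _ "\<eta> - \<theta>"]) auto
  qed

  have exact_R: "c ` carrier (W10 \<Lambda> vis a) = {x \<in> carrier (R11 \<Lambda> vis a). \<beta> x = \<zero>\<^bsub>?dK\<^esub>}"
  proof -
    have zero: "?b u = \<zero>\<^bsub>?dK\<^esub> \<longleftrightarrow> (\<exists>\<eta>. join u \<eta> \<in> ?h)" for u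
      unfolding b_zero_iff[symmetric] by (auto simp: restrict_def fun_eq_iff)
    \<comment> \<open>The image consists of the classes of those \<open>u\<close> that some \<eta>
      completes to an annihilating covector, which is the vanishing condition for \<beta> just
      obtained.\<close>
    have "c ` carrier (W10 \<Lambda> vis a) = {?R u | u. \<exists>\<eta>. join u \<eta> \<in> ?h}"
    proof (intro equalityI subsetI)
      fix x assume "x \<in> c ` carrier (W10 \<Lambda> vis a)"
      then obtain w where "w \<in> ?h" "x = c (?W w)" by (auto simp: W_car)
      then show "x \<in> {?R u | u. \<exists>\<eta>. join u \<eta> \<in> ?h}"
        using c by (cases w rule: join_cases) auto
    next
      fix x assume "x \<in> {?R u | u. \<exists>\<eta>. join u \<eta> \<in> ?h}"
      then obtain u \<eta> where "x = ?R u" "join u \<eta> \<in> ?h" by blast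
      then show "x \<in> c ` carrier (W10 \<Lambda> vis a)"
        unfolding W_car using c by (metis imageI)
    qed
    also have "\<dots> = {x \<in> carrier (R11 \<Lambda> vis a). \<beta> x = \<zero>\<^bsub>?dK\<^esub>}"
      unfolding R_car zero[symmetric] \<beta>[symmetric] by blast
    finally show ?thesis .
  qed

  have \<beta>_surj: "\<beta> ` carrier (R11 \<Lambda> vis a) = carrier ?dK"
  proof (intro equalityI subsetI)
    fix \<phi> assume "\<phi> \<in> \<beta> ` carrier (R11 \<Lambda> vis a)"
    moreover have "\<beta> \<in> carrier (R11 \<Lambda> vis a) \<rightarrow> carrier ?dK"
      using \<beta>_lin unfolding linear_maps_def[of "R11 \<Lambda> vis a"] by blast
    ultimately show "\<phi> \<in> carrier ?dK" by blast
  next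
    fix \<phi> assume \<phi>: "\<phi> \<in> carrier ?dK"
    \<comment> \<open>If both blocks vanish at \<open>T\<close>, so do all differences with the
      vector of \<open>a None\<close>, as every label is visible or indispensable; admissibility
      then forces \<open>T = 0\<close>.\<close>
    have inj: "T = 0" if "T \<in> mat_ker B" "A *v T = 0" for T
    proof (rule admissible_no_common_zero[OF assms(1)])
      have "pairing (\<Lambda> (vis j) - \<Lambda> (a None)) T = (A *v T) $ j" for j
        by (simp add: A_def block_A_def matrix_vector_mult_def pairing_def)
      moreover have "pairing (\<Lambda> (a (Some \<mu>)) - \<Lambda> (a None)) T = (B *v T) $ \<mu>" for \<mu>
        by (simp add: B_def block_B_def matrix_vector_mult_def pairing_def)
      moreover have "pairing (\<Lambda> (a None) - \<Lambda> (a None)) T = 0" by (simp add: pairing_zero_left)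
      ultimately have "pairing (\<Lambda> (vis j) - \<Lambda> (a None)) T = 0"
        "pairing (\<Lambda> (a k) - \<Lambda> (a None)) T = 0" for j k
        using that by (simp_all add: mat_ker_def) (cases k; simp)
      then show "pairing (\<Lambda> i - \<Lambda> (a None)) T = 0" for i
        using labels[of i] by auto
    qed
    obtain u where "\<forall>T\<in>mat_ker B. \<phi> T = pairing (transpose A *v u) T"
      using functional_eq_pairing_transpose[OF subspace_mat_ker[of B] inj, where \<phi> = \<phi>] \<phi> by auto
    then have "\<phi> = ?b u"
      using \<phi> by (auto simp: fun_eq_iff extensional_def restrict_def simp del: transpose_matrix_vector)
    then have "\<phi> = \<beta> (?R u)" by (simp only: \<beta>)
    then show "\<phi> \<in> \<beta> ` carrier (R11 \<Lambda> vis a)" unfolding R_car by blast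
  qed

  have "exact_sequence4 (dual_module (coker B)) \<iota> (W10 \<Lambda> vis a) c (R11 \<Lambda> vis a) \<beta> ?dK"
    unfolding exact_sequence4_def
    by (intro conjI M1 M2 module_R11 M4 \<iota>_lin c_lin \<beta>_lin \<iota>_inj exact_W exact_R \<beta>_surj)
  then show "\<exists>\<iota> c \<beta>.
        (\<forall>\<eta>\<in>?KT. \<iota> (coker_functional B \<eta>) = W_class \<Lambda> vis a 0 \<eta>) \<and>
        (\<forall>u \<eta>. join u \<eta> \<in> ?h \<longrightarrow> c (W_class \<Lambda> vis a u \<eta>) = ?R u) \<and>
        (\<forall>u. \<beta> (?R u) = ?b u) \<and>
        exact_sequence4 (dual_module (coker B)) \<iota> (W10 \<Lambda> vis a) c (R11 \<Lambda> vis a) \<beta> ?dK"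
    using \<iota> c \<beta> unfolding W_class_def by blast
qed

end
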